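(* For any exotic coloured tree $\tau\in\mathcal{T}^{\mathfrak e}_{\alpha,\beta}$, the exotic Connes–Moscovici weight satisfies $$CM^{\mathfrak e}(\tau)=\frac{|\tau|!}{\sigma_{\mathfrak e}(\tau)\,\tau!}.$$
   Context: Exotic coloured trees: an exotic coloured tree $\tau$ is a finite non-planar rooted tree with edges oriented towards the root; the root is uncoloured; every non-root vertex has a colour in $\{\alpha,\beta\}$; the set $\mathcal V_\beta(\tau)$ of $\beta$-coloured vertices has even cardinality and is equipped with an exotic decoration $\mathfrak e$, i.e. a partition of $\mathcal V_\beta(\tau)$ into pairs ($\mathfrak e(v)=\mathfrak e(w)$ iff $v,w$ are in the same pair; labels irrelevant). Paired vertices may be anywhere in the tree. $\mathcal V_\alpha(\tau)$ is the set of $\alpha$-coloured vertices, $\mathcal V(\tau)$ the set of all vertices. $\mathcal{T}^{\mathfrak e}_{\alpha,\beta}$ is the set of isomorphism classes of such trees (including the single root $\bullet$). Set $|\tau|:=|\mathcal V_\alpha(\tau)|+\tfrac12|\mathcal V_\beta(\tau)|+1$; $|\tau|!$ is the usual factorial of this integer. Symmetry factor: $\sigma_{\mathfrak e}(\tau)$ is the number of automorphisms of the rooted tree $\tau$ preserving the colours and the partition of $\mathcal V_\beta(\tau)$ into pairs (pairs may be permuted among themselves). Tree factorial: $1/\tau!$ is defined recursively by $1/\bullet!=1$ and, for $|\tau|>1$, $$\frac{|\tau|}{\tau!}=\sum_{\tau'}\frac{m_\alpha(\tau',\tau)}{\tau'!}+\sum_{\tau'}\frac{m_\beta(\tau',\tau)}{\tau'!},$$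 where $m_\alpha(\tau',\tau)$ is the number of $\alpha$-coloured leaves of $\tau$ whose removal yields $\tau'$, $m_\beta(\tau',\tau)$ is the number of pairs of $\beta$-vertices with the same exotic decoration, both leaves of $\tau$, whose simultaneous removal yields $\tau'$, and sums run over isomorphism classes. Empty sums are zero (in which case $1/\tau!=0$). Connes–Moscovici weight: natural growth builds trees starting from $\bullet$ by successive steps, each being either (i) the grafting of a new $\alpha$-leaf on a vertex $v\in\mathcal V(\sigma)$ of the current tree $\sigma$, or (ii) the simultaneous grafting of two new $\beta$-leaves, forming a new pair, one on $v$ and one on $w$, for an ordered pair $(v,w)\in\mathcal V(\sigma)\times\mathcal V(\sigma)$ ($v=w$ allowed). $CM^{\mathfrak e}(\tau)$ is the number of ways of obtaining $\tau$ (up to isomorphism) by natural growth, i.e. the coefficient of $\tau$ after $|\tau|-1$ growth steps applied linearly to $\bullet$ (summing at each step over all choices (i) and (ii)), multiplied by $2^{-|\mathcal V_\beta(\tau)|/2}$ (a factor $\tfrac12$ per grafted pair). In particular $CM^{\mathfrak e}(\bullet)=1$. *)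

theory Defs
  imports Complex_Main "HOL-Library.Disjoint_Sets" "HOL-Library.Poly_Mapping"
    "HOL-Combinatorics.Permutations"
begin

section \<open>Exotic coloured trees\<close>

text \<open>
  Representatives of isomorphism classes have natural numbers as vertices. An edge
  \<open>(u, v)\<close> points from the child \<open>u\<close> to its parent \<open>v\<close>, that is, towards
  the root. The colouring is given by its two colour classes \<open>alphas\<close> and
  \<open>betas\<close>, and the exotic decoration by the blocks of the partition of \<open>betas\<close>.
\<close>

record pretree =
  verts :: "nat set"
  root_vertex :: nat
  edges :: "(nat \<times> nat) set"
  alphas :: "nat set"
  betas :: "nat set"
  pairs :: "nat set set"

definition exotic_tree :: "pretree \<Rightarrow> bool" where
  "exotic_tree t \<longleftrightarrow>
     finite (verts t) \<and> root_vertex t \<in> verts t \<and> edges t \<subseteq> verts t \<times> verts t \<and>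
     (\<forall>v\<in>verts t - {root_vertex t}. \<exists>!w. (v, w) \<in> edges t) \<and>
     (\<forall>w. (root_vertex t, w) \<notin> edges t) \<and>
     (\<forall>v\<in>verts t. (v, root_vertex t) \<in> (edges t)\<^sup>*) \<and>
     alphas t \<union> betas t = verts t - {root_vertex t} \<and> alphas t \<inter> betas t = {} \<and>
     partition_on (betas t) (pairs t) \<and> (\<forall>p\<in>pairs t. card p = 2)"

definition is_iso :: "(nat \<Rightarrow> nat) \<Rightarrow> pretree \<Rightarrow> pretree \<Rightarrow> bool" where
  "is_iso f s t \<longleftrightarrow>
     bij_betw f (verts s) (verts t) \<and> f (root_vertex s) = root_vertex t \<and>
     map_prod f f ` edges s = edges t \<and>
     f ` alphas s = alphas t \<and> f ` betas s = betas t \<and>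
     (`) f ` pairs s = pairs t"

definition eiso :: "pretree \<Rightarrow> pretree \<Rightarrow> bool" where
  "eiso s t \<longleftrightarrow> exotic_tree s \<and> exotic_tree t \<and> (\<exists>f. is_iso f s t)"

definition bullet_rep :: pretree where
  "bullet_rep = \<lparr>verts = {0}, root_vertex = 0, edges = {}, alphas = {}, betas = {}, pairs = {}\<rparr>"

lemma exotic_tree_subsets:
  assumes "exotic_tree t"
  shows "finite (verts t)" "root_vertex t \<in> verts t" "edges t \<subseteq> verts t \<times> verts t"
    "alphas t \<subseteq> verts t" "betas t \<subseteq> verts t" "\<And>p. p \<in> pairs t \<Longrightarrow> p \<subseteq> verts t"
    "finite (alphas t)" "finite (betas t)"
proof -
  show 1: "finite (verts t)" "root_vertex t \<in> verts t" "edges t \<subseteq> verts t \<times> verts t"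
    using assms by (simp_all add: exotic_tree_def)
  have "alphas t \<union> betas t = verts t - {root_vertex t}"
    using assms by (simp add: exotic_tree_def)
  then show ab: "alphas t \<subseteq> verts t" "betas t \<subseteq> verts t" by blast+
  show "p \<subseteq> verts t" if "p \<in> pairs t" for p
    using assms ab that by (auto simp: exotic_tree_def partition_on_def)
  show "finite (alphas t)" "finite (betas t)" using 1 ab finite_subset by blast+
qed

lemma exotic_tree_bullet: "exotic_tree bullet_rep"
  by (auto simp: exotic_tree_def bullet_rep_def partition_on_def)

lemma is_iso_refl: "is_iso (\<lambda>x. x) t t"
  by (auto simp: is_iso_def bij_betw_def map_prod_def image_iff split: prod.splits)

lemma is_iso_trans: "is_iso f s t \<Longrightarrow> is_iso g t u \<Longrightarrow> is_iso (g \<circ> f) s u"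
  unfolding is_iso_def
proof (elim conjE, intro conjI)
  assume "(`) f ` pairs s = pairs t" "(`) g ` pairs t = pairs u"
  moreover have "(`) (g \<circ> f) ` pairs s = (`) g ` (`) f ` pairs s"
    by (simp add: image_image image_comp)
  ultimately show "(`) (g \<circ> f) ` pairs s = pairs u" by simp
next
  assume "map_prod f f ` edges s = edges t" "map_prod g g ` edges t = edges u"
  moreover have "map_prod (g \<circ> f) (g \<circ> f) ` edges s = map_prod g g ` map_prod f f ` edges s"
    by (simp add: map_prod_compose image_comp)
  ultimately show "map_prod (g \<circ> f) (g \<circ> f) ` edges s = edges u" by simp
qed (simp add: bij_betw_trans, simp, (metis image_comp)+)

lemma is_iso_inv:
  assumes s: "exotic_tree s" and f: "is_iso f s t"
  shows "is_iso (inv_into (verts s) f) t s"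
proof -
  let ?g = "inv_into (verts s) f"
  note sub = exotic_tree_subsets[OF s]
  have b: "bij_betw f (verts s) (verts t)" and i: "inj_on f (verts s)"
    using f by (auto simp: is_iso_def bij_betw_def)
  have gf: "?g ` f ` X = X" if "X \<subseteq> verts s" for X
    using i that by (rule inv_into_image_cancel)
  have e: "map_prod ?g ?g ` map_prod f f ` edges s = edges s"
  proof -
    have "map_prod ?g ?g (map_prod f f x) = x" if "x \<in> edges s" for x
      using that sub(3) i by (cases x) auto
    then show ?thesis by (simp add: image_image)
  qed
  have p: "(`) ?g ` (`) f ` pairs s = pairs s"
    using gf sub(6) by (simp add: image_image)
  have "?g ` f ` alphas s = alphas s" "?g ` f ` betas s = betas s" "?g (f (root_vertex s)) = root_vertex s"
    using gf sub(4,5) i sub(2) by simp_all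
  with e p f bij_betw_inv_into[OF b] show ?thesis
    by (simp add: is_iso_def)
qed

lemma eiso_part_equivp: "part_equivp eiso"
proof (rule part_equivpI)
  show "\<exists>x. eiso x x" using exotic_tree_bullet is_iso_refl by (auto simp: eiso_def)
  show "symp eiso" using is_iso_inv by (auto simp: eiso_def symp_def) 
  show "transp eiso" using is_iso_trans by (auto simp: eiso_def transp_def) blast
qed

text \<open>The isomorphism classes, i.e. the set \<open>T\<^sup>e\<^sub>\<alpha>\<^sub>\<beta>\<close>.\<close>

quotient_type etree = pretree / partial: eiso
  by (rule eiso_part_equivp)

lift_definition bullet :: etree is bullet_rep
  using exotic_tree_bullet is_iso_refl by (auto simp: eiso_def)

lemma eiso_card:
  assumes "eiso s t"
  shows "card (verts s) = card (verts t)" "card (alphas s) = card (alphas t)"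
    "card (betas s) = card (betas t)"
proof -
  obtain f where s: "exotic_tree s" and f: "is_iso f s t" using assms by (auto simp: eiso_def)
  have i: "inj_on f (verts s)" and v: "f ` verts s = verts t"
    using f by (auto simp: is_iso_def bij_betw_def)
  note sub = exotic_tree_subsets[OF s]
  show "card (verts s) = card (verts t)" "card (alphas s) = card (alphas t)"
    "card (betas s) = card (betas t)"
    using card_image[OF i] card_image[OF inj_on_subset[OF i sub(4)]]
      card_image[OF inj_on_subset[OF i sub(5)]] f v
    by (auto simp: is_iso_def)
qed

lift_definition num_alpha :: "etree \<Rightarrow> nat" is "\<lambda>t. card (alphas t)"
  by (rule eiso_card)

lift_definition num_beta :: "etree \<Rightarrow> nat" is "\<lambda>t. card (betas t)"
  by (rule eiso_card)

text \<open>The integer \<open>|\<tau>|\<close>; the division is exact, as \<open>num_beta \<tau>\<close> is even.\<close>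

definition esize :: "etree \<Rightarrow> nat" where
  "esize \<tau> = num_alpha \<tau> + num_beta \<tau> div 2 + 1"


section \<open>Symmetry factor\<close>

text \<open>
  An automorphism is a bijection of the vertex set; \<open>permutes\<close> extends it by the identity to
  all of \<open>nat\<close>, so that different functions are different automorphisms.
\<close>

lift_definition esigma :: "etree \<Rightarrow> nat" is
  "\<lambda>t. card {f. f permutes verts t \<and> is_iso f t t}"
proof -
  have le: "card {f. f permutes verts s \<and> is_iso f s s} \<le> card {f. f permutes verts t \<and> is_iso f t t}"
    if st: "eiso s t" for s t
  proof -
    obtain f where s: "exotic_tree s" and t: "exotic_tree t" and f: "is_iso f s t"
      using st by (auto simp: eiso_def)
    define g where "g = inv_into (verts s) f"
    have g: "is_iso g t s" unfolding g_def by (rule is_iso_inv[OF s f])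
    have bf: "bij_betw f (verts s) (verts t)" and bg: "bij_betw g (verts t) (verts s)"
      using f g by (auto simp: is_iso_def)
    have gf: "g (f x) = x" if "x \<in> verts s" for x
      using that bf by (simp add: g_def bij_betw_def)
    define h where "h = (\<lambda>a x. if x \<in> verts t then f (a (g x)) else x)"
    have cong: "is_iso b t t" if "is_iso a t t" "\<And>x. x \<in> verts t \<Longrightarrow> a x = b x" for a b
    proof -
      note sub = exotic_tree_subsets[OF t]
      have *: "b ` X = a ` X" if "X \<subseteq> verts t" for X
        using that \<open>\<And>x. x \<in> verts t \<Longrightarrow> a x = b x\<close> by (intro image_cong) auto
      have "map_prod b b ` edges t = map_prod a a ` edges t"
      proof (rule image_cong[OF refl])
        fix e assume "e \<in> edges t"
        then show "map_prod b b e = map_prod a a e"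
          using sub(3) that(2) by (cases e) auto
      qed
      moreover have "(`) b ` pairs t = (`) a ` pairs t"
        by (rule image_cong[OF refl]) (rule *, rule sub(6))
      moreover have "bij_betw b (verts t) (verts t)"
        using that bij_betw_cong[of "verts t" a b] by (auto simp: is_iso_def)
      ultimately show ?thesis
        using that *[OF sub(4)] *[OF sub(5)] sub(2) by (simp add: is_iso_def)
    qed
    show ?thesis
    proof (rule card_inj_on_le[where f = h])
      show "finite {f. f permutes verts t \<and> is_iso f t t}"
        using finite_permutations[OF exotic_tree_subsets(1)[OF t]] by simp
      show "h ` {f. f permutes verts s \<and> is_iso f s s} \<subseteq> {f. f permutes verts t \<and> is_iso f t t}"
      proof clarify
        fix a assume a: "a permutes verts s" "is_iso a s s"
        have i: "is_iso (f \<circ> (a \<circ> g)) t t"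
          by (rule is_iso_trans[OF is_iso_trans[OF g a(2)] f])
        have hi: "is_iso (h a) t t" by (rule cong[OF i]) (simp add: h_def)
        moreover have "h a permutes verts t"
          by (rule bij_imp_permutes) (use hi in \<open>auto simp: is_iso_def h_def\<close>)
        ultimately show "h a permutes verts t \<and> is_iso (h a) t t" by simp
      qed
      show "inj_on h {f. f permutes verts s \<and> is_iso f s s}"
      proof (rule inj_onI, clarify)
        fix a b assume a: "a permutes verts s" and b: "b permutes verts s" and ab: "h a = h b"
        show "a = b"
        proof
          fix x show "a x = b x"
          proof (cases "x \<in> verts s")
            case True
            then have fx: "f x \<in> verts t" using bf by (auto simp: bij_betw_def)
            have "h a (f x) = h b (f x)" using ab by simp
            then have "f (a x) = f (b x)" using fx gf[OF True] by (simp add: h_def)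
            moreover have "a x \<in> verts s" "b x \<in> verts s"
              using True a b by (simp_all add: permutes_in_image)
            ultimately show ?thesis using bf by (auto simp: bij_betw_def dest: inj_onD)
          next
            case False
            then show ?thesis using a b by (simp add: permutes_not_in)
          qed
        qed
      qed
    qed
  qed
  have "symp eiso" using eiso_part_equivp by (rule part_equivp_symp[THEN sympI])
  then show "eiso s t \<Longrightarrow> card {f. f permutes verts s \<and> is_iso f s s} = card {f. f permutes verts t \<and> is_iso f t t}"
    for s t using le[of s t] le[of t s] by (auto dest: sympD)
qed


section \<open>Removal of leaves and tree factorial\<close>

definition is_leaf :: "pretree \<Rightarrow> nat \<Rightarrow> bool" where
  "is_leaf t v \<longleftrightarrow> v \<in> verts t \<and> (\<forall>u. (u, v) \<notin> edges t)"

definition remove_verts :: "nat set \<Rightarrow> pretree \<Rightarrow> pretree" where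
  "remove_verts S t = t\<lparr>verts := verts t - S,
     edges := edges t \<inter> (verts t - S) \<times> (verts t - S),
     alphas := alphas t - S, betas := betas t - S,
     pairs := {p \<in> pairs t. p \<inter> S = {}}\<rparr>"

lemma exotic_tree_remove:
  assumes t: "exotic_tree t" and S: "\<And>v. v \<in> S \<Longrightarrow> is_leaf t v" "root_vertex t \<notin> S"
    and P: "\<And>p. p \<in> pairs t \<Longrightarrow> p \<inter> S = {} \<or> p \<subseteq> S"
  shows "exotic_tree (remove_verts S t)"
proof -
  note sub = exotic_tree_subsets[OF t]
  define E where "E = edges t \<inter> (verts t - S) \<times> (verts t - S)"
  have E: "(u, w) \<in> E \<longleftrightarrow> (u, w) \<in> edges t \<and> u \<notin> S" for u w
    using sub(3) S(1) by (auto simp: E_def is_leaf_def)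
  have r: "(u, root_vertex t) \<in> E\<^sup>*" if "(u, root_vertex t) \<in> (edges t)\<^sup>*" "u \<notin> S" for u
    using that
  proof (induction rule: converse_rtrancl_induct)
    case (step y z)
    have "z \<notin> S" using step.hyps S(1) by (auto simp: is_leaf_def)
    then have "(z, root_vertex t) \<in> E\<^sup>*" "(y, z) \<in> E" using step E by auto
    then show ?case by (rule converse_rtrancl_into_rtrancl[rotated])
  qed simp
  have u: "\<Union>(pairs t) = betas t" and d: "disjoint (pairs t)" and ne: "{} \<notin> pairs t"
    using t by (auto simp: exotic_tree_def partition_on_def)
  have "\<Union>{p \<in> pairs t. p \<inter> S = {}} = betas t - S"
  proof (intro equalityI subsetI)
    fix x assume "x \<in> betas t - S"
    then obtain p where "p \<in> pairs t" "x \<in> p" "x \<notin> S" unfolding u[symmetric] by auto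
    moreover from this have "p \<inter> S = {}" using P[of p] by auto
    ultimately show "x \<in> \<Union>{p \<in> pairs t. p \<inter> S = {}}" by auto
  qed (auto simp: u[symmetric])
  moreover have "disjoint {p \<in> pairs t. p \<inter> S = {}}"
    using d by (auto simp: disjoint_def)
  ultimately have "partition_on (betas t - S) {p \<in> pairs t. p \<inter> S = {}}"
    using ne by (simp add: partition_on_def)
  moreover have "\<exists>!w. (v, w) \<in> E" if "v \<in> verts t - S - {root_vertex t}" for v
  proof -
    have "\<exists>!w. (v, w) \<in> edges t" using t that by (simp add: exotic_tree_def)
    then show ?thesis using that E by simp
  qed
  moreover have "(v, root_vertex t) \<in> E\<^sup>*" if "v \<in> verts t - S" for v
    using t that r by (simp add: exotic_tree_def)
  moreover have "alphas t - S \<union> (betas t - S) = verts t - S - {root_vertex t}"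
    "alphas t \<inter> betas t = {}" "\<forall>w. (root_vertex t, w) \<notin> E" "\<forall>p\<in>pairs t. card p = 2"
    using t E by (auto simp: exotic_tree_def)
  ultimately show ?thesis
    using sub(1,2) S(2) unfolding exotic_tree_def remove_verts_def
    by (simp add: E_def[symmetric]) (auto simp: E_def)
qed

lemma exotic_tree_remove_alpha:
  assumes t: "exotic_tree t" and v: "v \<in> alphas t" "is_leaf t v"
  shows "exotic_tree (remove_verts {v} t)"
proof (rule exotic_tree_remove[OF t])
  have "v \<noteq> root_vertex t" "v \<notin> betas t" using t v by (auto simp: exotic_tree_def)
  have "\<Union>(pairs t) = betas t" using t by (simp add: exotic_tree_def partition_on_def)
  then show "p \<inter> {v} = {} \<or> p \<subseteq> {v}" if "p \<in> pairs t" for p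
    using that \<open>v \<notin> betas t\<close> by blast
  show "root_vertex t \<notin> {v}" using \<open>v \<noteq> root_vertex t\<close> by simp
  show "is_leaf t u" if "u \<in> {v}" for u using v that by simp
qed

lemma exotic_tree_remove_beta:
  assumes t: "exotic_tree t" and p: "p \<in> pairs t" "\<forall>v\<in>p. is_leaf t v"
  shows "exotic_tree (remove_verts p t)"
proof (rule exotic_tree_remove[OF t])
  have "\<Union>(pairs t) = betas t" "root_vertex t \<notin> betas t"
    using t by (auto simp: exotic_tree_def partition_on_def)
  then show "root_vertex t \<notin> p" using p(1) by blast
  show "is_leaf t u" if "u \<in> p" for u using p that by simp
  show "q \<inter> p = {} \<or> q \<subseteq> p" if "q \<in> pairs t" for q
  proof -
    have "disjoint (pairs t)" using t by (simp add: exotic_tree_def partition_on_def)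
    then show ?thesis using p(1) that disjointD by fast
  qed
qed

lemma is_iso_leaf:
  assumes s: "exotic_tree s" and f: "is_iso f s t" and v: "v \<in> verts s"
  shows "is_leaf t (f v) \<longleftrightarrow> is_leaf s v"
proof -
  have i: "inj_on f (verts s)" and V: "f ` verts s = verts t" and E: "map_prod f f ` edges s = edges t"
    using f by (auto simp: is_iso_def bij_betw_def)
  have "(\<exists>u. (u, f v) \<in> edges t) \<longleftrightarrow> (\<exists>u. (u, v) \<in> edges s)"
  proof
    assume "\<exists>u. (u, f v) \<in> edges t"
    then obtain a b where "(a, b) \<in> edges s" "f b = f v" unfolding E[symmetric] by auto
    moreover from this have "b = v"
      using exotic_tree_subsets(3)[OF s] i v by (auto dest: inj_onD)
    ultimately show "\<exists>u. (u, v) \<in> edges s" by blast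
  qed (use E in force)
  then show ?thesis using v V by (auto simp: is_leaf_def)
qed

lemma is_iso_remove:
  assumes s: "exotic_tree s" and f: "is_iso f s t" and S: "S \<subseteq> verts s" "root_vertex s \<notin> S"
  shows "is_iso f (remove_verts S s) (remove_verts (f ` S) t)"
proof -
  note sub = exotic_tree_subsets[OF s]
  have i: "inj_on f (verts s)" and V: "f ` verts s = verts t" and E: "map_prod f f ` edges s = edges t"
    and P: "(`) f ` pairs s = pairs t" and AB: "f ` alphas s = alphas t" "f ` betas s = betas t"
    and r: "f (root_vertex s) = root_vertex t"
    using f by (auto simp: is_iso_def bij_betw_def)
  have d: "f ` (X - S) = f ` X - f ` S" if "X \<subseteq> verts s" for X
    using i S(1) that by (auto simp: inj_on_def subset_iff)
  have "bij_betw f (verts s - S) (verts t - f ` S)"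
    using d[of "verts s"] V inj_on_subset[OF i] by (auto simp: bij_betw_def)
  moreover have "map_prod f f ` (edges s \<inter> (verts s - S) \<times> (verts s - S))
      = edges t \<inter> (verts t - f ` S) \<times> (verts t - f ` S)"
  proof -
    have "inj_on (map_prod f f) (verts s \<times> verts s)" using i by (simp add: map_prod_inj_on)
    then have "map_prod f f ` (edges s \<inter> (verts s - S) \<times> (verts s - S))
      = map_prod f f ` edges s \<inter> map_prod f f ` ((verts s - S) \<times> (verts s - S))"
      using sub(3) by (intro inj_on_image_Int) auto
    then show ?thesis using d[of "verts s"] E V by (simp add: map_prod_surj_on[OF refl refl])
  qed
  moreover have "(`) f ` {p \<in> pairs s. p \<inter> S = {}} = {p \<in> pairs t. p \<inter> f ` S = {}}"
  proof -
    have "f ` p \<inter> f ` S = {} \<longleftrightarrow> p \<inter> S = {}" if "p \<in> pairs s" for p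
      using inj_on_image_Int[OF i sub(6)[OF that] S(1)] by (metis image_is_empty)
    then show ?thesis unfolding P[symmetric] by blast
  qed
  ultimately show ?thesis
    using d sub(4,5) AB r by (simp add: is_iso_def remove_verts_def)
qed

lemma abs_etree_eqI: "eiso s t \<Longrightarrow> abs_etree s = abs_etree t"
  using Quotient_rel_abs[OF Quotient_etree] by blast

lemma abs_remove_alpha:
  assumes st: "exotic_tree s" "exotic_tree t" "is_iso f s t" and v: "v \<in> alphas s" "is_leaf s v"
  shows "abs_etree (remove_verts {f v} t) = abs_etree (remove_verts {v} s)"
proof -
  have vs: "v \<in> verts s" "root_vertex s \<noteq> v" using v st(1) by (auto simp: is_leaf_def exotic_tree_def)
  have "f v \<in> alphas t" "is_leaf t (f v)"
    using v st(3) is_iso_leaf[OF st(1,3) vs(1)] by (auto simp: is_iso_def)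
  then have "eiso (remove_verts {v} s) (remove_verts {f v} t)"
    using is_iso_remove[OF st(1,3), of "{v}"] vs st v exotic_tree_remove_alpha
    by (auto simp: eiso_def)
  then show ?thesis using abs_etree_eqI by metis
qed

lemma abs_remove_beta:
  assumes st: "exotic_tree s" "exotic_tree t" "is_iso f s t"
    and p: "p \<in> pairs s" "\<forall>v\<in>p. is_leaf s v"
  shows "abs_etree (remove_verts (f ` p) t) = abs_etree (remove_verts p s)"
proof -
  have ps: "p \<subseteq> verts s" "root_vertex s \<notin> p" using p st(1)
    by (auto simp: is_leaf_def exotic_tree_def partition_on_def)
  have "f ` p \<in> pairs t" "\<forall>v\<in>f ` p. is_leaf t v"
    using p st(3) is_iso_leaf[OF st(1,3)] ps(1) by (auto simp: is_iso_def)
  then have "eiso (remove_verts p s) (remove_verts (f ` p) t)"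
    using is_iso_remove[OF st(1,3) ps] st p exotic_tree_remove_beta
    by (auto simp: eiso_def)
  then show ?thesis using abs_etree_eqI by metis
qed

lift_definition m_alpha :: "etree \<Rightarrow> etree \<Rightarrow> nat" is
  "\<lambda>\<tau>' t. card {v \<in> alphas t. is_leaf t v \<and> abs_etree (remove_verts {v} t) = \<tau>'}"
proof -
  fix \<tau>' s t assume "eiso s t"
  then obtain f where st: "exotic_tree s" "exotic_tree t" "is_iso f s t" by (auto simp: eiso_def)
  let ?A = "{v \<in> alphas s. is_leaf s v \<and> abs_etree (remove_verts {v} s) = \<tau>'}"
  have i: "inj_on f (verts s)" and A: "f ` alphas s = alphas t"
    using st(3) by (auto simp: is_iso_def bij_betw_def)
  note sub = exotic_tree_subsets[OF st(1)]
  have "f ` ?A = {v \<in> alphas t. is_leaf t v \<and> abs_etree (remove_verts {v} t) = \<tau>'}"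
    unfolding A[symmetric] using sub(4) is_iso_leaf[OF st(1,3)] abs_remove_alpha[OF st]
    by (auto simp: image_iff subset_iff)
  moreover have "card (f ` ?A) = card ?A"
    using sub(4) by (intro card_image inj_on_subset[OF i]) auto
  ultimately show "card ?A = card {v \<in> alphas t. is_leaf t v \<and> abs_etree (remove_verts {v} t) = \<tau>'}"
    by simp
qed

lift_definition m_beta :: "etree \<Rightarrow> etree \<Rightarrow> nat" is
  "\<lambda>\<tau>' t. card {p \<in> pairs t. (\<forall>v\<in>p. is_leaf t v) \<and> abs_etree (remove_verts p t) = \<tau>'}"
proof -
  fix \<tau>' s t assume "eiso s t"
  then obtain f where st: "exotic_tree s" "exotic_tree t" "is_iso f s t" by (auto simp: eiso_def)
  let ?A = "{p \<in> pairs s. (\<forall>v\<in>p. is_leaf s v) \<and> abs_etree (remove_verts p s) = \<tau>'}"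
  let ?B = "{p \<in> pairs t. (\<forall>v\<in>p. is_leaf t v) \<and> abs_etree (remove_verts p t) = \<tau>'}"
  have i: "inj_on f (verts s)" and P: "(`) f ` pairs s = pairs t"
    using st(3) by (auto simp: is_iso_def bij_betw_def)
  note sub = exotic_tree_subsets[OF st(1)]
  have l: "(\<forall>v\<in>f ` p. is_leaf t v) \<longleftrightarrow> (\<forall>v\<in>p. is_leaf s v)" if "p \<in> pairs s" for p
    using sub(6)[OF that] is_iso_leaf[OF st(1,3)] by auto
  have "(\<forall>v\<in>f ` p. is_leaf t v) \<and> abs_etree (remove_verts (f ` p) t) = \<tau>' \<longleftrightarrow>
      (\<forall>v\<in>p. is_leaf s v) \<and> abs_etree (remove_verts p s) = \<tau>'" if "p \<in> pairs s" for p
    using l[OF that] abs_remove_beta[OF st that] by auto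
  then have "(`) f ` ?A = ?B"
    unfolding P[symmetric] by blast
  moreover have "inj_on ((`) f) ?A"
    by (rule inj_on_subset[OF inj_on_image_Pow[OF i]]) (use sub(6) in auto)
  then have "card ((`) f ` ?A) = card ?A" by (rule card_image)
  ultimately show "card ?A = card ?B" by simp
qed

lemma etree_rep:
  obtains t where "exotic_tree t" "\<tau> = abs_etree t"
proof -
  have "eiso (rep_etree \<tau>) (rep_etree \<tau>)" "abs_etree (rep_etree \<tau>) = \<tau>"
    by (rule Quotient3_rep_reflp[OF Quotient3_etree], rule Quotient3_abs_rep[OF Quotient3_etree])
  then show ?thesis using that[of "rep_etree \<tau>"] by (auto simp: eiso_def)
qed

lemma eiso_refl: "exotic_tree t \<Longrightarrow> eiso t t"
  using is_iso_refl by (auto simp: eiso_def)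

lemma esize_abs: "exotic_tree t \<Longrightarrow> esize (abs_etree t) = card (alphas t) + card (betas t) div 2 + 1"
  by (simp add: esize_def num_alpha.abs_eq num_beta.abs_eq eiso_refl)

lemma m_alpha_nonzeroD: "m_alpha \<tau>' \<tau> \<noteq> 0 \<Longrightarrow> esize \<tau> = esize \<tau>' + 1"
proof -
  assume m: "m_alpha \<tau>' \<tau> \<noteq> 0"
  obtain t where t: "exotic_tree t" "\<tau> = abs_etree t" by (rule etree_rep)
  have "{v \<in> alphas t. is_leaf t v \<and> abs_etree (remove_verts {v} t) = \<tau>'} \<noteq> {}"
    using m t by (metis (no_types, lifting) m_alpha.abs_eq eiso_refl card.empty)
  then obtain v where v: "v \<in> alphas t" "is_leaf t v" "abs_etree (remove_verts {v} t) = \<tau>'" by auto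
  have "v \<notin> betas t" using v t(1) by (auto simp: exotic_tree_def)
  then have "esize \<tau>' = card (alphas t - {v}) + card (betas t) div 2 + 1"
    using esize_abs[OF exotic_tree_remove_alpha[OF t(1) v(1,2)]] v(3) by (simp add: remove_verts_def)
  moreover have "card (alphas t) = Suc (card (alphas t - {v}))"
    using v(1) exotic_tree_subsets(7)[OF t(1)] by (metis card_Suc_Diff1)
  ultimately show ?thesis using t by (simp add: esize_abs)
qed

lemma m_beta_nonzeroD: "m_beta \<tau>' \<tau> \<noteq> 0 \<Longrightarrow> esize \<tau> = esize \<tau>' + 1"
proof -
  assume m: "m_beta \<tau>' \<tau> \<noteq> 0"
  obtain t where t: "exotic_tree t" "\<tau> = abs_etree t" by (rule etree_rep)
  have "{p \<in> pairs t. (\<forall>v\<in>p. is_leaf t v) \<and> abs_etree (remove_verts p t) = \<tau>'} \<noteq> {}"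
    using m t by (metis (no_types, lifting) m_beta.abs_eq eiso_refl card.empty)
  then obtain p where p: "p \<in> pairs t" "\<forall>v\<in>p. is_leaf t v" "abs_etree (remove_verts p t) = \<tau>'"
    by auto
  have pb: "p \<subseteq> betas t" "card p = 2" and ab: "alphas t \<inter> betas t = {}"
    using p t(1) by (auto simp: exotic_tree_def partition_on_def)
  then have "alphas t - p = alphas t" by blast
  then have "esize \<tau>' = card (alphas t) + card (betas t - p) div 2 + 1"
    using esize_abs[OF exotic_tree_remove_beta[OF t(1) p(1,2)]] p(3) by (simp add: remove_verts_def)
  moreover have "card (betas t) = card (betas t - p) + 2"
  proof -
    have f: "finite (betas t)" by (rule exotic_tree_subsets(8)[OF t(1)])
    have "card (betas t - p) = card (betas t) - 2"
      using pb f by (simp add: card_Diff_subset finite_subset)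
    moreover have "card p \<le> card (betas t)" using pb f by (intro card_mono)
    ultimately show ?thesis using pb(2) by simp
  qed
  ultimately show ?thesis using t by (simp add: esize_abs)
qed

text \<open>
  The rational number \<open>1 / \<tau>!\<close>, which may be zero. The sums over all isomorphism classes are
  restricted to the finitely many classes with nonzero coefficient, because \<open>sum\<close> over an
  infinite set is zero by convention.
\<close>

function inv_tree_fact :: "etree \<Rightarrow> rat" where
  "inv_tree_fact \<tau> = (if \<tau> = bullet then 1 else
     ((\<Sum>\<tau>'\<in>{\<tau>'. m_alpha \<tau>' \<tau> \<noteq> 0}. of_nat (m_alpha \<tau>' \<tau>) * inv_tree_fact \<tau>') +
      (\<Sum>\<tau>'\<in>{\<tau>'. m_beta \<tau>' \<tau> \<noteq> 0}. of_nat (m_beta \<tau>' \<tau>) * inv_tree_fact \<tau>'))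
     / of_nat (esize \<tau>))"
  by auto
termination
  by (relation "measure esize") (use m_alpha_nonzeroD m_beta_nonzeroD in fastforce)+

declare inv_tree_fact.simps [simp del]

lemma esize_bullet: "num_beta bullet = 0" "esize bullet = 1"
  using eiso_refl[OF exotic_tree_bullet]
  by (simp_all add: esize_def bullet.abs_eq num_alpha.abs_eq num_beta.abs_eq)
    (simp_all add: bullet_rep_def)

lemma inv_tree_fact_bullet: "inv_tree_fact bullet = 1"
  by (subst inv_tree_fact.simps) simp

lemma inv_tree_fact_rec:
  assumes "esize \<tau> > 1"
  shows "of_nat (esize \<tau>) * inv_tree_fact \<tau> =
     (\<Sum>\<tau>'\<in>{\<tau>'. m_alpha \<tau>' \<tau> \<noteq> 0}. of_nat (m_alpha \<tau>' \<tau>) * inv_tree_fact \<tau>') +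
     (\<Sum>\<tau>'\<in>{\<tau>'. m_beta \<tau>' \<tau> \<noteq> 0}. of_nat (m_beta \<tau>' \<tau>) * inv_tree_fact \<tau>')"
proof -
  have "\<tau> \<noteq> bullet" using assms by (auto simp: esize_bullet)
  then show ?thesis using assms by (subst (1) inv_tree_fact.simps) simp
qed

lemma finite_m_support:
  "finite {\<tau>'. m_alpha \<tau>' \<tau> \<noteq> 0}" "finite {\<tau>'. m_beta \<tau>' \<tau> \<noteq> 0}"
proof -
  obtain t where t: "exotic_tree t" "\<tau> = abs_etree t" by (rule etree_rep)
  have "{\<tau>'. m_alpha \<tau>' \<tau> \<noteq> 0} \<subseteq> (\<lambda>v. abs_etree (remove_verts {v} t)) ` alphas t"
    using t by (auto simp: m_alpha.abs_eq eiso_refl image_iff card_eq_0_iff)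
  then show "finite {\<tau>'. m_alpha \<tau>' \<tau> \<noteq> 0}"
    by (rule finite_subset) (simp add: exotic_tree_subsets[OF t(1)])
  have "finite (pairs t)"
    using exotic_tree_subsets(8)[OF t(1)] t(1) by (metis exotic_tree_def finite_elements)
  moreover have "{\<tau>'. m_beta \<tau>' \<tau> \<noteq> 0} \<subseteq> (\<lambda>p. abs_etree (remove_verts p t)) ` pairs t"
    using t by (auto simp: m_beta.abs_eq eiso_refl image_iff card_eq_0_iff)
  ultimately show "finite {\<tau>'. m_beta \<tau>' \<tau> \<noteq> 0}"
    by (metis finite_surj)
qed


section \<open>Natural growth and Connes--Moscovici weight\<close>

definition fresh :: "pretree \<Rightarrow> nat" where
  "fresh t = Suc (Max (verts t))"

definition graft_alpha :: "nat \<Rightarrow> pretree \<Rightarrow> pretree" where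
  "graft_alpha v t = (let n = fresh t in
     t\<lparr>verts := insert n (verts t), edges := insert (n, v) (edges t),
       alphas := insert n (alphas t)\<rparr>)"

definition graft_beta :: "nat \<Rightarrow> nat \<Rightarrow> pretree \<Rightarrow> pretree" where
  "graft_beta v w t = (let n = fresh t; m = Suc n in
     t\<lparr>verts := {n, m} \<union> verts t, edges := {(n, v), (m, w)} \<union> edges t,
       betas := {n, m} \<union> betas t, pairs := insert {n, m} (pairs t)\<rparr>)"

lemma fresh_notin:
  assumes "exotic_tree t"
  shows "fresh t \<notin> verts t" "Suc (fresh t) \<notin> verts t"
proof -
  have "x < fresh t" if "x \<in> verts t" for x
    using that exotic_tree_subsets(1)[OF assms] by (simp add: fresh_def less_Suc_eq_le)
  then show "fresh t \<notin> verts t" "Suc (fresh t) \<notin> verts t"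
    by (meson less_irrefl, meson less_Suc_eq not_less_iff_gr_or_eq)
qed

lemma exotic_tree_graft_alpha:
  assumes t: "exotic_tree t" and v: "v \<in> verts t"
  shows "exotic_tree (graft_alpha v t)"
proof -
  define n where "n = fresh t"
  note sub = exotic_tree_subsets[OF t]
  have n: "n \<notin> verts t" using fresh_notin[OF t] by (simp add: n_def)
  let ?E = "insert (n, v) (edges t)"
  have sE: "(edges t)\<^sup>* \<subseteq> ?E\<^sup>*" by (rule rtrancl_mono) auto
  have "(u, root_vertex t) \<in> ?E\<^sup>*" if "u \<in> verts t" for u
    using t that sE by (auto simp: exotic_tree_def)
  moreover from this[OF v] have "(n, root_vertex t) \<in> ?E\<^sup>*" by (meson converse_rtrancl_into_rtrancl insertI1)
  moreover have "\<exists>!w. (u, w) \<in> ?E" if "u \<in> insert n (verts t) - {root_vertex t}" for u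
  proof (cases "u = n")
    case True
    then show ?thesis using n sub(3) by auto
  next
    case False
    then have "\<exists>!w. (u, w) \<in> edges t" using t that by (simp add: exotic_tree_def)
    then show ?thesis using False by simp
  qed
  moreover have "insert n (alphas t) \<union> betas t = insert n (verts t) - {root_vertex t}"
    "insert n (alphas t) \<inter> betas t = {}"
    using t n sub(2,5) by (auto simp: exotic_tree_def)
  moreover have "\<forall>w. (root_vertex t, w) \<notin> ?E" using t n sub(2) by (auto simp: exotic_tree_def)
  moreover have "?E \<subseteq> insert n (verts t) \<times> insert n (verts t)" using v sub(3) by auto
  moreover have "partition_on (betas t) (pairs t)" "\<forall>p\<in>pairs t. card p = 2"
    using t by (simp_all add: exotic_tree_def)
  ultimately show ?thesis
    unfolding exotic_tree_def graft_alpha_def Let_def n_def[symmetric]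
    using sub(1,2) by (simp del: insert_iff Un_insert_left) simp
qed

lemma exotic_tree_graft_beta:
  assumes t: "exotic_tree t" and v: "v \<in> verts t" "w \<in> verts t"
  shows "exotic_tree (graft_beta v w t)"
proof -
  define n where "n = fresh t"
  define m where "m = Suc n"
  note sub = exotic_tree_subsets[OF t]
  have n: "n \<notin> verts t" "m \<notin> verts t" "n \<noteq> m"
    using fresh_notin[OF t] by (simp_all add: n_def m_def)
  let ?E = "{(n, v), (m, w)} \<union> edges t"
  have sE: "(edges t)\<^sup>* \<subseteq> ?E\<^sup>*" by (rule rtrancl_mono) auto
  have *: "(u, root_vertex t) \<in> ?E\<^sup>*" if "u \<in> verts t" for u
    using t that sE by (auto simp: exotic_tree_def)
  have "(n, v) \<in> ?E" "(m, w) \<in> ?E" by auto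
  then have "(n, root_vertex t) \<in> ?E\<^sup>*" "(m, root_vertex t) \<in> ?E\<^sup>*"
    using *[OF v(1)] *[OF v(2)] by (meson converse_rtrancl_into_rtrancl)+
  with * have reach: "\<forall>u\<in>{n, m} \<union> verts t. (u, root_vertex t) \<in> ?E\<^sup>*" by blast
  have uniq: "\<forall>u\<in>{n, m} \<union> verts t - {root_vertex t}. \<exists>!x. (u, x) \<in> ?E"
  proof
    fix u assume u: "u \<in> {n, m} \<union> verts t - {root_vertex t}"
    show "\<exists>!x. (u, x) \<in> ?E"
    proof (cases "u = n \<or> u = m")
      case True
      then show ?thesis using n sub(3) by auto
    next
      case False
      then have "\<exists>!x. (u, x) \<in> edges t" using t u by (simp add: exotic_tree_def)
      then show ?thesis using False by simp
    qed
  qed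
  have ab: "alphas t \<union> ({n, m} \<union> betas t) = {n, m} \<union> verts t - {root_vertex t}"
    "alphas t \<inter> ({n, m} \<union> betas t) = {}"
    using t n sub(2,4) by (auto simp: exotic_tree_def)
  have rt: "\<forall>x. (root_vertex t, x) \<notin> ?E" using t n sub(2) by (auto simp: exotic_tree_def)
  have po: "partition_on ({n, m} \<union> betas t) (insert {n, m} (pairs t))"
  proof -
    have "partition_on (betas t) (pairs t)" using t by (simp add: exotic_tree_def)
    moreover from this have "\<Union>(pairs t) = betas t" by (simp add: partition_on_def)
    moreover have d: "betas t \<inter> {n, m} = {}" using n sub(5) by blast
    moreover from d have "{n, m} \<union> betas t - {n, m} = betas t" by blast
    ultimately show ?thesis by (subst partition_on_insert) (auto simp: disjnt_def Int_commute)
  qed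
  have c: "\<forall>p\<in>insert {n, m} (pairs t). card p = 2"
    using t n(3) by (auto simp: exotic_tree_def)
  have E: "?E \<subseteq> ({n, m} \<union> verts t) \<times> ({n, m} \<union> verts t)"
    using v sub(3) by auto
  show ?thesis
    unfolding exotic_tree_def graft_beta_def Let_def n_def[symmetric] m_def[symmetric]
    using reach uniq ab rt po c E sub(1,2)
    by (simp del: Un_insert_left Un_insert_right)
qed

lemma eiso_graft_alpha:
  assumes st: "exotic_tree s" "exotic_tree t" "is_iso f s t" and v: "v \<in> verts s"
  shows "eiso (graft_alpha v s) (graft_alpha (f v) t)"
proof -
  define n k where "n = fresh s" and "k = fresh t"
  note sub = exotic_tree_subsets[OF st(1)]
  have n: "n \<notin> verts s" "k \<notin> verts t"
    using fresh_notin[OF st(1)] fresh_notin[OF st(2)] by (simp_all add: n_def k_def)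
  define g where "g = f(n := k)"
  have b: "bij_betw f (verts s) (verts t)" using st(3) by (simp add: is_iso_def)
  have gx: "g x = f x" if "x \<in> verts s" for x using that n by (auto simp: g_def)
  have gn: "g n = k" by (simp add: g_def)
  have gX: "g ` X = f ` X" if "X \<subseteq> verts s" for X using that gx by (intro image_cong) auto
  have "map_prod g g ` edges s = map_prod f f ` edges s"
    using sub(3) gx by (intro image_cong) auto
  moreover have "(`) g ` pairs s = (`) f ` pairs s" by (rule image_cong[OF refl]) (rule gX, rule sub(6))
  moreover have "bij_betw g (insert n (verts s)) (insert k (verts t))"
  proof -
    have "bij_betw g (verts s) (verts t)" using b gx bij_betw_cong by metis
    then show ?thesis using notIn_Un_bij_betw[of n "verts s" g "verts t"] n gn by simp
  qed
  ultimately have "is_iso g (graft_alpha v s) (graft_alpha (f v) t)"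
    using st(3) gX[OF sub(4)] gX[OF sub(5)] gx[OF sub(2)] gx[OF v] gn
    by (simp add: is_iso_def graft_alpha_def Let_def n_def[symmetric] k_def[symmetric])
  moreover have "f v \<in> verts t" using b v by (auto simp: bij_betw_def)
  ultimately show ?thesis
    using exotic_tree_graft_alpha st v by (auto simp: eiso_def)
qed

lemma eiso_graft_beta:
  assumes st: "exotic_tree s" "exotic_tree t" "is_iso f s t" and v: "v \<in> verts s" "w \<in> verts s"
  shows "eiso (graft_beta v w s) (graft_beta (f v) (f w) t)"
proof -
  define n k where "n = fresh s" and "k = fresh t"
  note sub = exotic_tree_subsets[OF st(1)]
  have n: "n \<notin> verts s" "k \<notin> verts t" "Suc n \<notin> verts s" "Suc k \<notin> verts t"
    using fresh_notin[OF st(1)] fresh_notin[OF st(2)] by (simp_all add: n_def k_def)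
  define g where "g = f(n := k, Suc n := Suc k)"
  have b: "bij_betw f (verts s) (verts t)" using st(3) by (simp add: is_iso_def)
  have gx: "g x = f x" if "x \<in> verts s" for x using that n by (auto simp: g_def)
  have gn: "g n = k" "g (Suc n) = Suc k" by (simp_all add: g_def)
  have gX: "g ` X = f ` X" if "X \<subseteq> verts s" for X using that gx by (intro image_cong) auto
  have "map_prod g g ` edges s = map_prod f f ` edges s"
    using sub(3) gx by (intro image_cong) auto
  moreover have "(`) g ` pairs s = (`) f ` pairs s" by (rule image_cong[OF refl]) (rule gX, rule sub(6))
  moreover have "bij_betw g (insert n (insert (Suc n) (verts s))) (insert k (insert (Suc k) (verts t)))"
  proof -
    have "bij_betw g (verts s) (verts t)" using b gx bij_betw_cong by metis
    then have "bij_betw g (insert (Suc n) (verts s)) (insert (Suc k) (verts t))"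
      using notIn_Un_bij_betw[of "Suc n" "verts s" g "verts t"] n gn by simp
    then show ?thesis
      using notIn_Un_bij_betw[of n "insert (Suc n) (verts s)" g "insert (Suc k) (verts t)"] n gn by simp
  qed
  ultimately have "is_iso g (graft_beta v w s) (graft_beta (f v) (f w) t)"
    using st(3) gX[OF sub(4)] gX[OF sub(5)] gx[OF sub(2)] gx[OF v(1)] gx[OF v(2)] gn
    by (simp add: is_iso_def graft_beta_def Let_def n_def[symmetric] k_def[symmetric])
  moreover have "f v \<in> verts t" "f w \<in> verts t" using b v by (auto simp: bij_betw_def)
  ultimately show ?thesis
    using exotic_tree_graft_beta st v by (auto simp: eiso_def)
qed

text \<open>One growth step applied to a single tree, as a formal sum of isomorphism classes.\<close>

lift_definition growth :: "etree \<Rightarrow> etree \<Rightarrow>\<^sub>0 int" is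
  "\<lambda>t. (\<Sum>v\<in>verts t. frag_of (abs_etree (graft_alpha v t))) +
       (\<Sum>(v, w)\<in>verts t \<times> verts t. frag_of (abs_etree (graft_beta v w t)))"
proof -
  fix s t assume "eiso s t"
  then obtain f where st: "exotic_tree s" "exotic_tree t" "is_iso f s t" by (auto simp: eiso_def)
  have b: "bij_betw f (verts s) (verts t)" using st(3) by (simp add: is_iso_def)
  have b2: "bij_betw (map_prod f f) (verts s \<times> verts s) (verts t \<times> verts t)"
    using b by (auto simp: bij_betw_def map_prod_inj_on map_prod_surj_on)
  have "(\<Sum>v\<in>verts s. frag_of (abs_etree (graft_alpha v s)))
      = (\<Sum>v\<in>verts s. frag_of (abs_etree (graft_alpha (f v) t)))"
    using abs_etree_eqI[OF eiso_graft_alpha[OF st]] by (intro sum.cong) auto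
  also have "\<dots> = (\<Sum>v\<in>verts t. frag_of (abs_etree (graft_alpha v t)))"
    by (rule sum.reindex_bij_betw[OF b])
  finally have 1: "(\<Sum>v\<in>verts s. frag_of (abs_etree (graft_alpha v s)))
      = (\<Sum>v\<in>verts t. frag_of (abs_etree (graft_alpha v t)))" .
  have "(\<Sum>(v, w)\<in>verts s \<times> verts s. frag_of (abs_etree (graft_beta v w s)))
      = (\<Sum>x\<in>verts s \<times> verts s. (\<lambda>(v, w). frag_of (abs_etree (graft_beta v w t))) (map_prod f f x))"
    using abs_etree_eqI[OF eiso_graft_beta[OF st]] by (intro sum.cong) auto
  also have "\<dots> = (\<Sum>(v, w)\<in>verts t \<times> verts t. frag_of (abs_etree (graft_beta v w t)))"
    by (rule sum.reindex_bij_betw[OF b2])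
  finally show "(\<Sum>v\<in>verts s. frag_of (abs_etree (graft_alpha v s))) +
       (\<Sum>(v, w)\<in>verts s \<times> verts s. frag_of (abs_etree (graft_beta v w s))) =
      (\<Sum>v\<in>verts t. frag_of (abs_etree (graft_alpha v t))) +
       (\<Sum>(v, w)\<in>verts t \<times> verts t. frag_of (abs_etree (graft_beta v w t)))"
    using 1 by simp
qed

definition CM :: "etree \<Rightarrow> rat" where
  "CM \<tau> = (1 / 2) ^ (num_beta \<tau> div 2) *
     of_int (Poly_Mapping.lookup ((frag_extend growth ^^ (esize \<tau> - 1)) (frag_of bullet)) \<tau>)"

lemma CM_bullet: "CM bullet = 1"
  by (simp add: CM_def esize_bullet)

end

theory Submission
  imports Defs
begin

text \<open>
  Write \<open>L(\<tau>) = |\<tau>|! / \<tau>!\<close>. Multiplying the recursion of \<open>1 / \<tau>!\<close> by \<open>(|\<tau>| - 1)!\<close> shows that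
  \<open>L(\<tau>)\<close> is the sum of \<open>(m\<^sub>\<alpha>(\<tau>', \<tau>) + m\<^sub>\<beta>(\<tau>', \<tau>)) L(\<tau>')\<close> over the trees \<open>\<tau>'\<close> with one growth step
  less: \<open>L\<close> counts the ways to dismantle \<open>\<tau>\<close> down to the root. The Connes--Moscovici weight
  counts the ways to build \<open>\<tau>\<close> from the root. The two counts are linked one step at a time, by
  a double counting of isomorphisms.

  Fix trees \<open>s\<close> and \<open>t\<close>. An isomorphism from a tree grown from \<open>s\<close> onto \<open>t\<close> is the same thing as
  a choice of removable leaves of \<open>t\<close> (the images of the new vertices) together with an
  isomorphism from \<open>s\<close> onto what is left of \<open>t\<close> without them: in one direction one restricts to
  the old vertices, in the other the parents of the removed leaves tell where to graft
  (\<open>isos_graft_alpha_bij\<close>, \<open>isos_graft_beta_bij\<close>). As the number of isomorphisms between two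
  isomorphic trees is the symmetry factor (\<open>card_isos\<close>), counting both sides gives
  \<open>n(s, t) \<sigma>(t) = (m\<^sub>\<alpha>(s, t) + 2 m\<^sub>\<beta>(s, t)) \<sigma>(s)\<close>, where \<open>n(s, t)\<close> is the coefficient of \<open>t\<close> in one
  growth step applied to \<open>s\<close> (\<open>growth_coefficient\<close>). The factor \<open>2\<close> is there because
  growth grafts ordered pairs of leaves, whereas \<open>m\<^sub>\<beta>\<close> counts unordered ones; it cancels the factor
  \<open>1/2\<close> per pair in the weight.

  Hence the product of the weight and the symmetry factor satisfies the recursion of \<open>L\<close>, and
  both are \<open>1\<close> at the single root (\<open>growth_weight_eq\<close>).
\<close>

section \<open>Counting isomorphisms\<close>

lemma is_iso_cong:
  assumes s: "exotic_tree s" and fg: "\<And>x. x \<in> verts s \<Longrightarrow> f x = g x"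
  shows "is_iso f s t \<longleftrightarrow> is_iso g s t"
proof -
  note sub = exotic_tree_subsets[OF s]
  have im: "f ` X = g ` X" if "X \<subseteq> verts s" for X
    using that fg by (intro image_cong) auto
  have "map_prod f f ` edges s = map_prod g g ` edges s"
    using sub(3) fg by (intro image_cong) auto
  moreover have "(`) f ` pairs s = (`) g ` pairs s"
    by (intro image_cong refl im sub(6))
  moreover have "bij_betw f (verts s) (verts t) \<longleftrightarrow> bij_betw g (verts s) (verts t)"
    using fg by (rule bij_betw_cong)
  ultimately show ?thesis
    using im[OF sub(4)] im[OF sub(5)] fg[OF sub(2)] by (simp add: is_iso_def)
qed

text \<open>
  Restricting to \<open>extensional\<close> functions makes distinct elements of this set distinct maps on the
  vertices, so that its cardinality is the number of isomorphisms.
\<close>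

definition isos :: "pretree \<Rightarrow> pretree \<Rightarrow> (nat \<Rightarrow> nat) set" where
  "isos s t = {f \<in> extensional (verts s). is_iso f s t}"

lemma finite_isos:
  assumes "exotic_tree s" "exotic_tree t"
  shows "finite (isos s t)"
proof (rule finite_subset)
  show "isos s t \<subseteq> verts s \<rightarrow>\<^sub>E verts t"
    by (auto simp: isos_def is_iso_def bij_betw_def PiE_def)
  show "finite (verts s \<rightarrow>\<^sub>E verts t)"
    using assms by (intro finite_PiE exotic_tree_subsets)
qed

lemma abs_etree_eq_iff:
  "exotic_tree s \<Longrightarrow> exotic_tree t \<Longrightarrow> abs_etree s = abs_etree t \<longleftrightarrow> eiso s t"
  using Quotient3_rel[OF Quotient3_etree] eiso_refl by metis

lemma esigma_abs:
  "exotic_tree t \<Longrightarrow> esigma (abs_etree t) = card {f. f permutes verts t \<and> is_iso f t t}"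
  by (simp add: esigma.abs_eq eiso_refl)

lemma esigma_pos: "esigma \<tau> > 0"
proof -
  obtain t where t: "exotic_tree t" "\<tau> = abs_etree t" by (rule etree_rep)
  have "(\<lambda>x. x) \<in> {f. f permutes verts t \<and> is_iso f t t}"
    using is_iso_refl permutes_id[of "verts t"] by (simp add: id_def)
  moreover have "finite {f. f permutes verts t \<and> is_iso f t t}"
    using finite_permutations[OF exotic_tree_subsets(1)[OF t(1)]] by simp
  ultimately show ?thesis using t by (auto simp: esigma_abs card_gt_0_iff)
qed

text \<open>
  Composing with one fixed isomorphism turns the automorphisms of \<open>s\<close> into all the isomorphisms
  from \<open>s\<close> to \<open>t\<close>.
\<close>

lemma card_isos:
  assumes s: "exotic_tree s" and t: "exotic_tree t"
  shows "card (isos s t) = (if abs_etree s = abs_etree t then esigma (abs_etree s) else 0)"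
proof (cases "eiso s t")
  case True
  then obtain f where f: "is_iso f s t" by (auto simp: eiso_def)
  have b: "bij_betw f (verts s) (verts t)" and i: "inj_on f (verts s)"
    using f by (auto simp: is_iso_def bij_betw_def)
  let ?A = "{a. a permutes verts s \<and> is_iso a s s}"
  let ?h = "\<lambda>a. restrict (f \<circ> a) (verts s)"
  have "bij_betw ?h ?A (isos s t)"
  proof (rule bij_betw_imageI)
    show "inj_on ?h ?A"
    proof (rule inj_onI, clarify)
      fix a a' assume a: "a permutes verts s" "a' permutes verts s" and eq: "?h a = ?h a'"
      show "a = a'"
      proof
        fix x show "a x = a' x"
        proof (cases "x \<in> verts s")
          case True
          then have "f (a x) = f (a' x)" using fun_cong[OF eq, of x] by simp
          then show ?thesis using i a True by (simp add: inj_on_eq_iff permutes_in_image)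
        qed (use a in \<open>simp add: permutes_not_in\<close>)
      qed
    qed
    show "?h ` ?A = isos s t"
    proof (intro equalityI subsetI)
      fix g assume "g \<in> ?h ` ?A"
      then obtain a where a: "is_iso a s s" "g = ?h a" by auto
      have "is_iso g s t"
        using is_iso_trans[OF a(1) f] is_iso_cong[OF s, of g "f \<circ> a"] a(2) by simp
      then show "g \<in> isos s t" using a(2) by (simp add: isos_def)
    next
      fix g assume "g \<in> isos s t"
      then have g: "g \<in> extensional (verts s)" "is_iso g s t" by (auto simp: isos_def)
      define a where "a x = (if x \<in> verts s then inv_into (verts s) f (g x) else x)" for x
      have "is_iso a s s"
        using is_iso_trans[OF g(2) is_iso_inv[OF s f]]
          is_iso_cong[OF s, of a "inv_into (verts s) f \<circ> g"] by (simp add: a_def)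
      moreover from this have "a permutes verts s"
        by (intro bij_imp_permutes) (auto simp: is_iso_def a_def)
      moreover have "?h a = g"
      proof
        fix x show "?h a x = g x"
        proof (cases "x \<in> verts s")
          case True
          then have "g x \<in> f ` verts s" using g(2) b by (auto simp: is_iso_def bij_betw_def)
          then show ?thesis using True by (simp add: a_def f_inv_into_f)
        qed (use g(1) in \<open>simp add: extensional_def\<close>)
      qed
      ultimately show "g \<in> ?h ` ?A" by blast
    qed
  qed
  from bij_betw_same_card[OF this] show ?thesis
    using True s t by (simp add: abs_etree_eq_iff esigma_abs)
next
  case False
  then have "isos s t = {}" using s t by (auto simp: isos_def eiso_def)
  then show ?thesis using False s t by (simp add: abs_etree_eq_iff)
qed

section \<open>Growing and pruning leaves\<close>

lemma pair_subset_betas: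
  assumes "exotic_tree t" "p \<in> pairs t"
  shows "p \<subseteq> betas t"
proof -
  have "\<Union>(pairs t) = betas t" using assms(1) by (simp add: exotic_tree_def partition_on_def)
  then show ?thesis using assms(2) by blast
qed

lemma parent_exists:
  assumes "exotic_tree t" "u \<in> verts t" "u \<noteq> root_vertex t"
  obtains w where "(u, w) \<in> edges t"
proof -
  have "\<exists>!w. (u, w) \<in> edges t" using assms by (simp add: exotic_tree_def)
  then show ?thesis using that by blast
qed

lemma parent_unique:
  assumes "exotic_tree t" "(u, w) \<in> edges t" "(u, w') \<in> edges t"
  shows "w = w'"
proof -
  have "\<forall>w. (root_vertex t, w) \<notin> edges t" using assms(1) by (simp add: exotic_tree_def)
  then have "u \<in> verts t - {root_vertex t}"
    using assms(2) exotic_tree_subsets(3)[OF assms(1)] by auto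
  then have "\<exists>!w. (u, w) \<in> edges t" using assms(1) by (simp add: exotic_tree_def)
  then show ?thesis using assms(2,3) by blast
qed

lemma edges_prune:
  assumes t: "exotic_tree t" and L: "\<And>v. v \<in> S \<Longrightarrow> is_leaf t v"
  shows "edges t = edges (remove_verts S t) \<union> {(u, w) \<in> edges t. u \<in> S}"
  using exotic_tree_subsets(3)[OF t] L by (auto simp: remove_verts_def is_leaf_def)

text \<open>
  This converts an isomorphism of pruned trees into one of the full trees. For the edges it is
  enough that parents of removed leaves go to parents: every edge of \<open>t\<close> that leaves \<open>M\<close> is then
  hit, because a leaf in \<open>N\<close> has a parent and its image has only one.
\<close>

lemma is_iso_extend:
  assumes s: "exotic_tree s" and N: "\<And>v. v \<in> N \<Longrightarrow> is_leaf s v" "root_vertex s \<notin> N"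
    and t: "exotic_tree t" and M: "\<And>v. v \<in> M \<Longrightarrow> is_leaf t v"
    and g: "is_iso g (remove_verts N s) (remove_verts M t)" "bij_betw g N M"
    and parents: "\<And>u v. u \<in> N \<Longrightarrow> (u, v) \<in> edges s \<Longrightarrow> (g u, g v) \<in> edges t"
    and alphas: "g ` (alphas s \<inter> N) = alphas t \<inter> M"
    and betas: "g ` (betas s \<inter> N) = betas t \<inter> M"
    and pairs: "(`) g ` {p \<in> pairs s. p \<inter> N \<noteq> {}} = {p \<in> pairs t. p \<inter> M \<noteq> {}}"
  shows "is_iso g s t"
proof -
  have sub: "N \<subseteq> verts s" "M \<subseteq> verts t" using N(1) M by (auto simp: is_leaf_def)
  have "bij_betw g (verts s - N) (verts t - M)"
    using g(1) by (simp add: is_iso_def remove_verts_def)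
  then have "bij_betw g (N \<union> (verts s - N)) (M \<union> (verts t - M))"
    using g(2) by (intro bij_betw_combine) auto
  then have bij: "bij_betw g (verts s) (verts t)" using sub by (simp add: Un_absorb1)
  have "map_prod g g ` {(u, v) \<in> edges s. u \<in> N} = {(u, v) \<in> edges t. u \<in> M}"
  proof (intro equalityI subsetI)
    fix e assume "e \<in> map_prod g g ` {(u, v) \<in> edges s. u \<in> N}"
    then show "e \<in> {(u, v) \<in> edges t. u \<in> M}"
      using parents g(2) by (auto simp: bij_betw_def)
  next
    fix e assume "e \<in> {(u, v) \<in> edges t. u \<in> M}"
    then obtain n w where e: "e = (g n, w)" "n \<in> N" "(g n, w) \<in> edges t"
      using g(2) by (auto simp: bij_betw_def)
    have "n \<in> verts s" "n \<noteq> root_vertex s" using e(2) sub N(2) by auto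
    from parent_exists[OF s this] obtain v where v: "(n, v) \<in> edges s" .
    have "w = g v" by (rule parent_unique[OF t e(3) parents[OF e(2) v]])
    then show "e \<in> map_prod g g ` {(u, v) \<in> edges s. u \<in> N}" using e v by force
  qed
  moreover have "map_prod g g ` edges (remove_verts N s) = edges (remove_verts M t)"
    using g(1) by (simp add: is_iso_def)
  moreover have "edges s = edges (remove_verts N s) \<union> {(u, v) \<in> edges s. u \<in> N}"
    using s N(1) by (rule edges_prune)
  then have "map_prod g g ` edges s = map_prod g g ` edges (remove_verts N s)
      \<union> map_prod g g ` {(u, v) \<in> edges s. u \<in> N}"
    by (metis (no_types, lifting) image_Un)
  moreover have "edges t = edges (remove_verts M t) \<union> {(u, v) \<in> edges t. u \<in> M}"
    using t M by (rule edges_prune)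
  ultimately have edges: "map_prod g g ` edges s = edges t" by argo
  have colour: "g ` A = B" if "g ` (A \<inter> N) = B \<inter> M" "g ` (A - N) = B - M" for A B
  proof -
    have "g ` A = g ` (A \<inter> N) \<union> g ` (A - N)" by blast
    then show ?thesis unfolding that by blast
  qed
  have "g ` (alphas s - N) = alphas t - M" "g ` (betas s - N) = betas t - M"
    using g(1) by (simp_all add: is_iso_def remove_verts_def)
  then have "g ` alphas s = alphas t" "g ` betas s = betas t"
    using colour[OF alphas] colour[OF betas] by blast+
  moreover have "(`) g ` pairs s = pairs t"
  proof -
    have *: "pairs r = {p \<in> pairs r. p \<inter> S \<noteq> {}} \<union> {p \<in> pairs r. p \<inter> S = {}}"
      for r :: pretree and S by auto
    have "(`) g ` {p \<in> pairs s. p \<inter> N = {}} = {p \<in> pairs t. p \<inter> M = {}}"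
      using g(1) by (simp add: is_iso_def remove_verts_def)
    moreover have "(`) g ` pairs s = (`) g ` {p \<in> pairs s. p \<inter> N \<noteq> {}}
        \<union> (`) g ` {p \<in> pairs s. p \<inter> N = {}}"
      unfolding image_Un[symmetric] *[symmetric] ..
    ultimately show ?thesis using pairs *[of t M] by argo
  qed
  ultimately show ?thesis
    using bij edges g(1) by (simp add: is_iso_def remove_verts_def)
qed

lemma prune_graft_alpha:
  assumes s: "exotic_tree s" and v: "v \<in> verts s"
  shows "remove_verts {fresh s} (graft_alpha v s) = s"
    and "is_leaf (graft_alpha v s) (fresh s)"
proof -
  note sub = exotic_tree_subsets[OF s] and n = fresh_notin[OF s]
  have "fresh s \<noteq> v" "fresh s \<notin> alphas s" "fresh s \<notin> betas s"
    and "\<And>p. p \<in> pairs s \<Longrightarrow> fresh s \<notin> p"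
    and "\<And>u w. (u, w) \<in> edges s \<Longrightarrow> u \<noteq> fresh s \<and> w \<noteq> fresh s"
    using n(1) v sub(3-6) by blast+
  then show "remove_verts {fresh s} (graft_alpha v s) = s"
    and "is_leaf (graft_alpha v s) (fresh s)"
    using n(1) sub(3) by (auto simp: remove_verts_def graft_alpha_def Let_def is_leaf_def
      intro!: pretree.equality)
qed

lemma prune_graft_beta:
  assumes s: "exotic_tree s" and v: "v \<in> verts s" "w \<in> verts s"
  shows "remove_verts {fresh s, Suc (fresh s)} (graft_beta v w s) = s"
    and "\<And>u. u \<in> {fresh s, Suc (fresh s)} \<Longrightarrow> is_leaf (graft_beta v w s) u"
proof -
  note sub = exotic_tree_subsets[OF s] and n = fresh_notin[OF s]
  have "\<And>p. p \<in> pairs s \<Longrightarrow> fresh s \<notin> p \<and> Suc (fresh s) \<notin> p"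
    "\<And>u w. (u, w) \<in> edges s \<Longrightarrow> u \<in> verts s \<and> w \<in> verts s"
    "fresh s \<notin> alphas s" "Suc (fresh s) \<notin> alphas s" "fresh s \<notin> betas s" "Suc (fresh s) \<notin> betas s"
    "v \<noteq> fresh s" "v \<noteq> Suc (fresh s)" "w \<noteq> fresh s" "w \<noteq> Suc (fresh s)"
    using n v sub(3-6) by blast+
  then show "remove_verts {fresh s, Suc (fresh s)} (graft_beta v w s) = s"
    and "\<And>u. u \<in> {fresh s, Suc (fresh s)} \<Longrightarrow> is_leaf (graft_beta v w s) u"
    using n by (auto simp: remove_verts_def graft_beta_def Let_def is_leaf_def
      intro!: pretree.equality)
qed

text \<open>
  The vertex \<open>v\<close> on the left-hand side is determined by the data on the right: its image is the
  parent of the leaf \<open>u\<close> in \<open>t\<close>. It survives the pruning, since a parent is not a leaf.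
\<close>

lemma isos_graft_alpha_bij:
  assumes s: "exotic_tree s" and t: "exotic_tree t"
  shows "bij_betw (\<lambda>(v, g). (g (fresh s), restrict g (verts s)))
    (SIGMA v:verts s. isos (graft_alpha v s) t)
    (SIGMA u:{u \<in> alphas t. is_leaf t u}. isos s (remove_verts {u} t))"
    (is "bij_betw ?h ?A ?B")
proof (rule bij_betw_imageI)
  let ?n = "fresh s"
  note n = fresh_notin(1)[OF s] and sub = exotic_tree_subsets[OF s]
  have V: "verts (graft_alpha v s) = insert ?n (verts s)" for v
    by (simp add: graft_alpha_def Let_def)
  have new_edge: "(?n, v) \<in> edges (graft_alpha v s)" for v
    by (simp add: graft_alpha_def Let_def)
  have push: "(f a, f b) \<in> edges t" if "is_iso f r t" "(a, b) \<in> edges r" for f r a b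
    using that by (force simp: is_iso_def)
  show "inj_on ?h ?A"
  proof (rule inj_onI, clarify)
    fix v g v' g'
    assume v: "v \<in> verts s" "v' \<in> verts s"
      and g: "g \<in> isos (graft_alpha v s) t" "g' \<in> isos (graft_alpha v' s) t"
      and eq: "g ?n = g' ?n" "restrict g (verts s) = restrict g' (verts s)"
    have eqs: "g x = g' x" if "x \<in> verts s" for x
      using that fun_cong[OF eq(2), of x] by simp
    then have gg: "g = g'"
      using g eq(1) by (intro extensionalityI[of _ "insert ?n (verts s)"]) (auto simp: isos_def V)
    have "(g ?n, g v) \<in> edges t" "(g ?n, g v') \<in> edges t"
      using g push new_edge unfolding gg by (auto simp: isos_def)
    then have "g v = g v'" by (rule parent_unique[OF t])
    then have "v = v'"
      using g(1) v by (auto simp: isos_def is_iso_def bij_betw_def V dest: inj_onD)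
    with gg show "v = v' \<and> g = g'" by simp
  qed
  show "?h ` ?A = ?B"
  proof (intro equalityI subsetI)
    fix y assume "y \<in> ?h ` ?A"
    then obtain v g where v: "v \<in> verts s" and g: "is_iso g (graft_alpha v s) t"
      and y: "y = (g ?n, restrict g (verts s))" by (auto simp: isos_def)
    note gr = exotic_tree_graft_alpha[OF s v] and pr = prune_graft_alpha[OF s v]
    have "g ?n \<in> alphas t" using g by (auto simp: is_iso_def graft_alpha_def Let_def)
    moreover have "is_leaf t (g ?n)" using is_iso_leaf[OF gr g] pr(2) by (simp add: V)
    moreover have "root_vertex (graft_alpha v s) \<notin> {?n}"
      using sub(2) n by (auto simp: graft_alpha_def Let_def)
    then have "is_iso g s (remove_verts {g ?n} t)"
      using is_iso_remove[OF gr g, of "{?n}"] pr(1) by (simp add: V)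
    then have "is_iso (restrict g (verts s)) s (remove_verts {g ?n} t)"
      using is_iso_cong[OF s, of "restrict g (verts s)" g] by simp
    ultimately show "y \<in> ?B" by (simp add: y isos_def)
  next
    fix y assume "y \<in> ?B"
    then obtain u f where u: "u \<in> alphas t" "is_leaf t u" and y: "y = (u, f)"
      and f: "f \<in> extensional (verts s)" "is_iso f s (remove_verts {u} t)"
      by (auto simp: isos_def)
    have "alphas t \<subseteq> verts t - {root_vertex t}" "alphas t \<inter> betas t = {}"
      using t by (auto simp: exotic_tree_def)
    then have "u \<in> verts t" "u \<noteq> root_vertex t" "u \<notin> betas t" using u(1) by auto
    from parent_exists[OF t this(1,2)] obtain w where w: "(u, w) \<in> edges t" .
    have "w \<in> verts t - {u}" using w u(2) exotic_tree_subsets(3)[OF t] by (auto simp: is_leaf_def)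
    then have "w \<in> f ` verts s" using f(2) by (auto simp: is_iso_def bij_betw_def remove_verts_def)
    then obtain v where v: "v \<in> verts s" "w = f v" by auto
    note gr = exotic_tree_graft_alpha[OF s v(1)] and pr = prune_graft_alpha[OF s v(1)]
    \<comment> \<open>Grafting on the vertex that corresponds to the parent of the removed leaf undoes the removal.\<close>
    define g where "g = f(?n := u)"
    have gf: "g x = f x" if "x \<in> verts s" for x using that n by (auto simp: g_def)
    have "is_iso g (graft_alpha v s) t"
    proof (rule is_iso_extend[OF gr _ _ t, where N = "{?n}" and M = "{u}"])
      show "is_iso g (remove_verts {?n} (graft_alpha v s)) (remove_verts {u} t)"
        using is_iso_cong[OF s gf] f(2) by (simp add: pr(1))
      show "(g a, g b) \<in> edges t" if "a \<in> {?n}" "(a, b) \<in> edges (graft_alpha v s)" for a b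
      proof -
        have "b = v" using that parent_unique[OF gr] new_edge by auto
        then show ?thesis using that(1) w v gf by (simp add: g_def)
      qed
      have pt: "u \<notin> p" if "p \<in> pairs t" for p
        using pair_subset_betas[OF t that] \<open>u \<notin> betas t\<close> by blast
      have ps: "?n \<notin> p" if "p \<in> pairs s" for p using that sub(6) n by blast
      show "(`) g ` {p \<in> pairs (graft_alpha v s). p \<inter> {?n} \<noteq> {}} = {p \<in> pairs t. p \<inter> {u} \<noteq> {}}"
        using pt ps by (auto simp: graft_alpha_def Let_def)
      show "g ` (betas (graft_alpha v s) \<inter> {?n}) = betas t \<inter> {u}"
        using \<open>u \<notin> betas t\<close> sub(5) n by (auto simp: graft_alpha_def Let_def)
      show "root_vertex (graft_alpha v s) \<notin> {?n}"
        using sub(2) n by (auto simp: graft_alpha_def Let_def)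
    qed (use u pr in \<open>auto simp: g_def graft_alpha_def Let_def bij_betw_def\<close>)
    moreover have "g \<in> extensional (verts (graft_alpha v s))"
      using f(1) by (auto simp: V g_def extensional_def)
    moreover have "restrict g (verts s) = f"
      using gf f(1) by (auto simp: fun_eq_iff extensional_def)
    moreover have "g ?n = u" by (simp add: g_def)
    ultimately show "y \<in> ?h ` ?A" using v(1) by (force simp: y isos_def)
  qed
qed

text \<open>
  The two new leaves are told apart by their grafting vertices \<open>(v, w)\<close>, so an isomorphism singles
  out an \<^emph>\<open>ordered\<close> pair \<open>(x, y)\<close> of leaves of \<open>t\<close>. This is also true if \<open>v = w\<close>, where
  \<open>(x, y)\<close> and \<open>(y, x)\<close> arise from two isomorphisms of the same grafted tree.
\<close>

lemma isos_graft_beta_bij: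
  assumes s: "exotic_tree s" and t: "exotic_tree t"
  shows "bij_betw (\<lambda>((v, w), g). ((g (fresh s), g (Suc (fresh s))), restrict g (verts s)))
    (SIGMA (v, w):verts s \<times> verts s. isos (graft_beta v w s) t)
    (SIGMA (x, y):{(x, y). {x, y} \<in> pairs t \<and> is_leaf t x \<and> is_leaf t y}.
       isos s (remove_verts {x, y} t))"
    (is "bij_betw ?h ?A ?B")
proof (rule bij_betw_imageI)
  let ?n = "fresh s" and ?m = "Suc (fresh s)"
  note n = fresh_notin[OF s] and sub = exotic_tree_subsets[OF s]
  have V: "verts (graft_beta v w s) = insert ?n (insert ?m (verts s))" for v w
    by (simp add: graft_beta_def Let_def)
  have new_edges: "(?n, v) \<in> edges (graft_beta v w s)" "(?m, w) \<in> edges (graft_beta v w s)" for v w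
    by (simp_all add: graft_beta_def Let_def)
  have push: "(f a, f b) \<in> edges t" if "is_iso f r t" "(a, b) \<in> edges r" for f r a b
    using that by (force simp: is_iso_def)
  show "inj_on ?h ?A"
  proof (rule inj_onI)
    fix z z' assume zz: "z \<in> ?A" "z' \<in> ?A" "?h z = ?h z'"
    obtain v w g v' w' g' where z: "z = ((v, w), g)" "z' = ((v', w'), g')"
      by (metis prod.exhaust)
    have v: "v \<in> verts s" "w \<in> verts s" "v' \<in> verts s" "w' \<in> verts s"
      and g: "g \<in> isos (graft_beta v w s) t" "g' \<in> isos (graft_beta v' w' s) t"
      and eq: "g ?n = g' ?n" "g ?m = g' ?m" "restrict g (verts s) = restrict g' (verts s)"
      using zz by (simp_all add: z)
    have eqs: "g x = g' x" if "x \<in> verts s" for x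
      using that fun_cong[OF eq(3), of x] by simp
    then have gg: "g = g'"
      using g eq(1,2) by (intro extensionalityI[of _ "insert ?n (insert ?m (verts s))"])
        (auto simp: isos_def V)
    have "(g ?n, g v) \<in> edges t" "(g ?n, g v') \<in> edges t"
      "(g ?m, g w) \<in> edges t" "(g ?m, g w') \<in> edges t"
      using g push new_edges unfolding gg by (auto simp: isos_def)
    then have "g v = g v'" "g w = g w'" by (auto intro: parent_unique[OF t])
    moreover have "inj_on g (verts s)"
      using g(1) by (auto simp: isos_def is_iso_def bij_betw_def V inj_on_def)
    ultimately have "v = v'" "w = w'" using v by (auto dest: inj_onD)
    with gg show "z = z'" by (simp add: z)
  qed
  show "?h ` ?A = ?B"
  proof (intro equalityI subsetI)
    fix y assume "y \<in> ?h ` ?A"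
    then obtain v w g where v: "v \<in> verts s" "w \<in> verts s" and g: "is_iso g (graft_beta v w s) t"
      and y: "y = ((g ?n, g ?m), restrict g (verts s))" by (auto simp: isos_def)
    note gr = exotic_tree_graft_beta[OF s v] and pr = prune_graft_beta[OF s v]
    have "{?n, ?m} \<in> pairs (graft_beta v w s)" by (simp add: graft_beta_def Let_def)
    then have "g ` {?n, ?m} \<in> (`) g ` pairs (graft_beta v w s)" by (rule imageI)
    then have "{g ?n, g ?m} \<in> pairs t" using g by (simp add: is_iso_def)
    moreover have "is_leaf t (g ?n)" "is_leaf t (g ?m)"
      using is_iso_leaf[OF gr g] pr(2) by (simp_all add: V)
    moreover have "root_vertex (graft_beta v w s) \<notin> {?n, ?m}"
      using sub(2) n by (auto simp: graft_beta_def Let_def)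
    then have "is_iso g s (remove_verts {g ?n, g ?m} t)"
      using is_iso_remove[OF gr g, of "{?n, ?m}"] pr(1) by (simp add: V)
    then have "is_iso (restrict g (verts s)) s (remove_verts {g ?n, g ?m} t)"
      using is_iso_cong[OF s, of "restrict g (verts s)" g] by simp
    ultimately show "y \<in> ?B" by (simp add: y isos_def)
  next
    fix y assume "y \<in> ?B"
    then obtain a b f where p: "{a, b} \<in> pairs t" "is_leaf t a" "is_leaf t b" and y: "y = ((a, b), f)"
      and f: "f \<in> extensional (verts s)" "is_iso f s (remove_verts {a, b} t)"
      by (auto simp: isos_def)
    have ab: "a \<noteq> b" using p(1) t by (auto simp: exotic_tree_def)
    have beta: "a \<in> betas t" "b \<in> betas t" using pair_subset_betas[OF t p(1)] by auto
    have "betas t \<subseteq> verts t - {root_vertex t}" "alphas t \<inter> betas t = {}"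
      using t by (auto simp: exotic_tree_def)
    then have nab: "a \<in> verts t" "a \<noteq> root_vertex t" "b \<in> verts t" "b \<noteq> root_vertex t"
      "a \<notin> alphas t" "b \<notin> alphas t"
      using beta by auto
    have parent: "\<exists>v\<in>verts s. (u, f v) \<in> edges t" if u: "u \<in> verts t" "u \<noteq> root_vertex t" for u
    proof -
      from parent_exists[OF t u] obtain w where w: "(u, w) \<in> edges t" .
      then have "w \<in> verts t - {a, b}"
        using p exotic_tree_subsets(3)[OF t] by (auto simp: is_leaf_def)
      then have "w \<in> f ` verts s" using f(2) by (auto simp: is_iso_def bij_betw_def remove_verts_def)
      then show ?thesis using w by auto
    qed
    obtain v w where v: "v \<in> verts s" "w \<in> verts s" and e: "(a, f v) \<in> edges t" "(b, f w) \<in> edges t"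
      using parent nab by metis
    note gr = exotic_tree_graft_beta[OF s v] and pr = prune_graft_beta[OF s v]
    define g where "g = f(?n := a, ?m := b)"
    have gf: "g x = f x" if "x \<in> verts s" for x using that n by (auto simp: g_def)
    have gnm: "g ?n = a" "g ?m = b" by (simp_all add: g_def)
    have "is_iso g (graft_beta v w s) t"
    proof (rule is_iso_extend[OF gr _ _ t, where N = "{?n, ?m}" and M = "{a, b}"])
      show "is_iso g (remove_verts {?n, ?m} (graft_beta v w s)) (remove_verts {a, b} t)"
        using is_iso_cong[OF s gf] f(2) by (simp add: pr(1))
      show "(g c, g d) \<in> edges t" if "c \<in> {?n, ?m}" "(c, d) \<in> edges (graft_beta v w s)" for c d
      proof -
        have "c = ?n \<and> d = v \<or> c = ?m \<and> d = w"
          using that parent_unique[OF gr] new_edges by blast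
        then show ?thesis using e v gf gnm by auto
      qed
      have pt: "q = {a, b}" if "q \<in> pairs t" "a \<in> q \<or> b \<in> q" for q
      proof -
        have "disjoint (pairs t)" using t by (simp add: exotic_tree_def partition_on_def)
        then show ?thesis using p(1) that by (metis disjointD disjoint_iff insertI1 insertI2)
      qed
      have ps: "?n \<notin> q" "?m \<notin> q" if "q \<in> pairs s" for q using that sub(6) n by blast+
      have "{q \<in> pairs (graft_beta v w s). q \<inter> {?n, ?m} \<noteq> {}} = {{?n, ?m}}"
      proof -
        have "pairs (graft_beta v w s) = insert {?n, ?m} (pairs s)"
          by (simp add: graft_beta_def Let_def)
        moreover have "q \<inter> {?n, ?m} = {}" if "q \<in> pairs s" for q using ps[OF that] by blast
        ultimately show ?thesis by blast
      qed
      moreover have "{q \<in> pairs t. q \<inter> {a, b} \<noteq> {}} = {{a, b}}" using p(1) pt by blast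
      ultimately show "(`) g ` {q \<in> pairs (graft_beta v w s). q \<inter> {?n, ?m} \<noteq> {}}
          = {q \<in> pairs t. q \<inter> {a, b} \<noteq> {}}" by (simp add: gnm)
      show "g ` (alphas (graft_beta v w s) \<inter> {?n, ?m}) = alphas t \<inter> {a, b}"
        using nab sub(4) n by (auto simp: graft_beta_def Let_def)
      have "betas (graft_beta v w s) \<inter> {?n, ?m} = {?n, ?m}"
        by (auto simp: graft_beta_def Let_def)
      then show "g ` (betas (graft_beta v w s) \<inter> {?n, ?m}) = betas t \<inter> {a, b}"
        using beta gnm by auto
      show "root_vertex (graft_beta v w s) \<notin> {?n, ?m}"
        using sub(2) n by (auto simp: graft_beta_def Let_def)
      show "bij_betw g {?n, ?m} {a, b}" using ab by (auto simp: bij_betw_def gnm)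
    qed (use p pr in auto)
    moreover have "g \<in> extensional (verts (graft_beta v w s))"
      using f(1) by (auto simp: V g_def extensional_def)
    moreover have "restrict g (verts s) = f"
      using gf f(1) by (auto simp: fun_eq_iff extensional_def)
    ultimately show "y \<in> ?h ` ?A" using v gnm by (force simp: y isos_def)
  qed
qed


lemma card_ordered_pairs:
  assumes "finite P" "\<And>p. p \<in> P \<Longrightarrow> card p = 2"
  shows "finite {(x, y). {x, y} \<in> P}" "card {(x, y). {x, y} \<in> P} = 2 * card P"
proof -
  let ?O = "\<lambda>p. {(x, y). {x, y} = p}"
  have two: "finite (?O p) \<and> card (?O p) = 2" if "p \<in> P" for p
  proof -
    have "card p = 2" using that by (rule assms(2))
    then obtain a b where p: "p = {a, b}" "a \<noteq> b" by (auto simp: card_2_iff)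
    then have "?O p = {(a, b), (b, a)}" by (auto simp: doubleton_eq_iff)
    then show ?thesis using p(2) by simp
  qed
  have U: "{(x, y). {x, y} \<in> P} = (\<Union>p\<in>P. ?O p)" by auto
  show "finite {(x, y). {x, y} \<in> P}" unfolding U using assms(1) two by auto
  have "card (\<Union>p\<in>P. ?O p) = (\<Sum>p\<in>P. card (?O p))"
    using assms(1) two by (intro card_UN_disjoint) auto
  also have "\<dots> = 2 * card P" using two by simp
  finally show "card {(x, y). {x, y} \<in> P} = 2 * card P" unfolding U .
qed

section \<open>Coefficients of one growth step\<close>

lemma growth_count_alpha:
  assumes s: "exotic_tree s" and t: "exotic_tree t"
  shows "card {v \<in> verts s. abs_etree (graft_alpha v s) = abs_etree t} * esigma (abs_etree t)
    = m_alpha (abs_etree s) (abs_etree t) * esigma (abs_etree s)"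
proof -
  note fin = exotic_tree_subsets(1,7)
  let ?L = "{u \<in> alphas t. is_leaf t u}"
  have "card {v \<in> verts s. abs_etree (graft_alpha v s) = abs_etree t} * esigma (abs_etree t)
      = (\<Sum>v\<in>verts s. if abs_etree (graft_alpha v s) = abs_etree t then esigma (abs_etree t) else 0)"
    using fin(1)[OF s] by (simp add: sum.If_cases Int_def)
  also have "\<dots> = (\<Sum>v\<in>verts s. card (isos (graft_alpha v s) t))"
    using card_isos[OF exotic_tree_graft_alpha[OF s] t] by (intro sum.cong) auto
  also have "\<dots> = card (SIGMA v:verts s. isos (graft_alpha v s) t)"
    using finite_isos[OF exotic_tree_graft_alpha[OF s] t] fin(1)[OF s] by simp
  also have "\<dots> = card (SIGMA u:?L. isos s (remove_verts {u} t))"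
    by (rule bij_betw_same_card[OF isos_graft_alpha_bij[OF s t]])
  also have "\<dots> = (\<Sum>u\<in>?L. card (isos s (remove_verts {u} t)))"
    using finite_isos[OF s exotic_tree_remove_alpha[OF t]] fin(2)[OF t] by simp
  also have "\<dots> = (\<Sum>u\<in>?L. if abs_etree (remove_verts {u} t) = abs_etree s
      then esigma (abs_etree s) else 0)"
    using card_isos[OF s exotic_tree_remove_alpha[OF t]] by (intro sum.cong) auto
  also have "\<dots> = m_alpha (abs_etree s) (abs_etree t) * esigma (abs_etree s)"
    using fin(2)[OF t] t by (simp add: sum.If_cases Int_def m_alpha.abs_eq eiso_refl conj_assoc)
  finally show ?thesis .
qed

text \<open>Each removable pair of leaves is counted twice, once for each of its orders.\<close>

lemma growth_count_beta:
  assumes s: "exotic_tree s" and t: "exotic_tree t"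
  shows "card {(v, w) \<in> verts s \<times> verts s. abs_etree (graft_beta v w s) = abs_etree t}
      * esigma (abs_etree t)
    = 2 * m_beta (abs_etree s) (abs_etree t) * esigma (abs_etree s)"
proof -
  have fin: "finite (verts s \<times> verts s)" using exotic_tree_subsets(1)[OF s] by simp
  let ?P = "{p \<in> pairs t. \<forall>u\<in>p. is_leaf t u}"
  let ?Q = "{p \<in> ?P. abs_etree (remove_verts p t) = abs_etree s}"
  let ?L = "{(x, y). {x, y} \<in> pairs t \<and> is_leaf t x \<and> is_leaf t y}"
  have L: "?L = {(x, y). {x, y} \<in> ?P}" by auto
  have "finite (pairs t)" "\<And>p. p \<in> pairs t \<Longrightarrow> card p = 2"
    using t exotic_tree_subsets(8)[OF t] by (auto simp: exotic_tree_def intro: finite_elements)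
  then have fin2: "finite ?P" "finite ?Q" "\<And>p. p \<in> ?P \<Longrightarrow> card p = 2" "\<And>p. p \<in> ?Q \<Longrightarrow> card p = 2"
    by simp_all
  have finL: "finite ?L" unfolding L using fin2(1,3) by (rule card_ordered_pairs)
  have two: "card {(x, y). {x, y} \<in> ?Q} = 2 * card ?Q" using fin2(2,4) by (rule card_ordered_pairs)
  have "card {(v, w) \<in> verts s \<times> verts s. abs_etree (graft_beta v w s) = abs_etree t}
        * esigma (abs_etree t)
      = (\<Sum>x\<in>verts s \<times> verts s. if abs_etree (case x of (v, w) \<Rightarrow> graft_beta v w s) = abs_etree t
          then esigma (abs_etree t) else 0)"
    using fin by (simp add: sum.If_cases Int_def case_prod_beta' mem_Times_iff conj_assoc)
  also have "\<dots> = (\<Sum>x\<in>verts s \<times> verts s. card (case x of (v, w) \<Rightarrow> isos (graft_beta v w s) t))"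
    using card_isos[OF exotic_tree_graft_beta[OF s] t] by (intro sum.cong) auto
  also have "\<dots> = card (SIGMA (v, w):verts s \<times> verts s. isos (graft_beta v w s) t)"
    using fin finite_isos[OF exotic_tree_graft_beta[OF s] t]
    by (intro card_SigmaI[symmetric]) auto
  also have "\<dots> = card (SIGMA (x, y):?L. isos s (remove_verts {x, y} t))"
    by (rule bij_betw_same_card[OF isos_graft_beta_bij[OF s t]])
  also have "\<dots> = (\<Sum>z\<in>?L. card (case z of (x, y) \<Rightarrow> isos s (remove_verts {x, y} t)))"
    using finL finite_isos[OF s exotic_tree_remove_beta[OF t]]
    by (intro card_SigmaI) auto
  also have "\<dots> = (\<Sum>z\<in>?L. if abs_etree (remove_verts {fst z, snd z} t) = abs_etree s
      then esigma (abs_etree s) else 0)"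
    using card_isos[OF s exotic_tree_remove_beta[OF t]] by (intro sum.cong) auto
  also have "\<dots> = card {(x, y). {x, y} \<in> ?Q} * esigma (abs_etree s)"
  proof -
    have "?L \<inter> {z. abs_etree (remove_verts {fst z, snd z} t) = abs_etree s} = {(x, y). {x, y} \<in> ?Q}"
      by auto
    then show ?thesis using finL by (simp add: sum.If_cases)
  qed
  also have "\<dots> = 2 * m_beta (abs_etree s) (abs_etree t) * esigma (abs_etree s)"
    unfolding two using t by (simp add: m_beta.abs_eq eiso_refl conj_assoc)
  finally show ?thesis .
qed

lemma lookup_growth:
  assumes s: "exotic_tree s"
  shows "Poly_Mapping.lookup (growth (abs_etree s)) \<tau>
    = int (card {v \<in> verts s. abs_etree (graft_alpha v s) = \<tau>})
    + int (card {(v, w) \<in> verts s \<times> verts s. abs_etree (graft_beta v w s) = \<tau>})"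
proof -
  have fin: "finite (verts s)" using s by (rule exotic_tree_subsets)
  have count: "(\<Sum>x\<in>X. Poly_Mapping.lookup (frag_of (h x)) \<tau>) = int (card {x \<in> X. h x = \<tau>})"
    if "finite X" for X :: "'b set" and h
    using that by (simp add: sum.If_cases Int_def eq_commute[of \<tau>])
  have "(\<Sum>x\<in>verts s \<times> verts s. Poly_Mapping.lookup
      (case x of (v, w) \<Rightarrow> frag_of (abs_etree (graft_beta v w s))) \<tau>)
    = (\<Sum>x\<in>verts s \<times> verts s. Poly_Mapping.lookup
      (frag_of (case x of (v, w) \<Rightarrow> abs_etree (graft_beta v w s))) \<tau>)"
    by (intro sum.cong) auto
  also have "\<dots> = int (card {(v, w) \<in> verts s \<times> verts s. abs_etree (graft_beta v w s) = \<tau>})"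
    using count[of "verts s \<times> verts s"] fin by (simp add: case_prod_beta' mem_Times_iff conj_assoc)
  finally show ?thesis
    using s count[OF fin] by (simp add: growth.abs_eq eiso_refl lookup_add lookup_sum)
qed

text \<open>
  The symmetry between grafting and removal: up to symmetry factors, and a factor \<open>2\<close> for the order
  of a grafted pair, growth is the transpose of pruning.
\<close>

lemma growth_coefficient:
  "Poly_Mapping.lookup (growth \<tau>') \<tau> * int (esigma \<tau>)
    = int (m_alpha \<tau>' \<tau> + 2 * m_beta \<tau>' \<tau>) * int (esigma \<tau>')"
proof -
  obtain s where s: "exotic_tree s" "\<tau>' = abs_etree s" by (rule etree_rep)
  obtain t where t: "exotic_tree t" "\<tau> = abs_etree t" by (rule etree_rep)
  show ?thesis
    using growth_count_alpha[OF s(1) t(1)] growth_count_beta[OF s(1) t(1)]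
    unfolding s(2) t(2) lookup_growth[OF s(1)]
    by (simp add: distrib_right flip: of_nat_mult of_nat_add)
qed

section \<open>The weight and the tree factorial satisfy the same recursion\<close>

text \<open>
  As \<open>esize\<close> rounds the number of pairs down, a tree with a single \<open>\<beta>\<close>-vertex has to be excluded;
  the partition into pairs makes the number of \<open>\<beta>\<close>-vertices even.
\<close>

lemma esize_eq_1D:
  assumes "esize \<tau> = 1"
  shows "\<tau> = bullet"
proof -
  obtain t where t: "exotic_tree t" "\<tau> = abs_etree t" by (rule etree_rep)
  note sub = exotic_tree_subsets[OF t(1)]
  have part: "partition_on (betas t) (pairs t)" and two: "\<forall>p\<in>pairs t. card p = 2"
    using t(1) by (simp_all add: exotic_tree_def)
  have "card (betas t) = (\<Sum>p\<in>pairs t. card p)"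
    using part by (rule product_partition) (use sub(8) part in \<open>auto simp: partition_on_def intro: finite_subset\<close>)
  then have "card (betas t) = 2 * card (pairs t)" using two by simp
  then have "card (alphas t) = 0" "card (betas t) = 0"
    using assms t by (auto simp: esize_abs)
  then have ab: "alphas t = {}" "betas t = {}" using sub(7,8) by auto
  then have "verts t = {root_vertex t}" "pairs t = {}"
    using t(1) part sub(2) by (auto simp: exotic_tree_def partition_on_def)
  moreover from this have "edges t = {}" using t(1) sub(3) by (auto simp: exotic_tree_def)
  ultimately have "is_iso (\<lambda>_. 0) t bullet_rep"
    using ab by (auto simp: is_iso_def bullet_rep_def bij_betw_def)
  then have "eiso t bullet_rep" using t(1) exotic_tree_bullet by (auto simp: eiso_def)
  then show ?thesis using t(2) by (simp add: abs_etree_eqI bullet.abs_eq)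
qed

lemma num_beta_remove_alpha:
  assumes "m_alpha \<tau>' \<tau> \<noteq> 0"
  shows "num_beta \<tau>' = num_beta \<tau>"
proof -
  obtain t where t: "exotic_tree t" "\<tau> = abs_etree t" by (rule etree_rep)
  have "{v \<in> alphas t. is_leaf t v \<and> abs_etree (remove_verts {v} t) = \<tau>'} \<noteq> {}"
    using assms t by (metis (no_types, lifting) m_alpha.abs_eq eiso_refl card.empty)
  then obtain v where v: "v \<in> alphas t" "is_leaf t v" "\<tau>' = abs_etree (remove_verts {v} t)" by auto
  have "v \<notin> betas t" using v t(1) by (auto simp: exotic_tree_def)
  then show ?thesis
    using t v exotic_tree_remove_alpha[OF t(1) v(1,2)]
    by (simp add: num_beta.abs_eq eiso_refl remove_verts_def)
qed

lemma num_beta_remove_beta: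
  assumes "m_beta \<tau>' \<tau> \<noteq> 0"
  shows "num_beta \<tau> div 2 = Suc (num_beta \<tau>' div 2)"
proof -
  obtain t where t: "exotic_tree t" "\<tau> = abs_etree t" by (rule etree_rep)
  have "{p \<in> pairs t. (\<forall>v\<in>p. is_leaf t v) \<and> abs_etree (remove_verts p t) = \<tau>'} \<noteq> {}"
    using assms t by (metis (no_types, lifting) m_beta.abs_eq eiso_refl card.empty)
  then obtain p where p: "p \<in> pairs t" "\<forall>v\<in>p. is_leaf t v" "\<tau>' = abs_etree (remove_verts p t)"
    by auto
  have "alphas t \<inter> betas t = {}" using t(1) by (simp add: exotic_tree_def)
  then have "alphas t - p = alphas t" using pair_subset_betas[OF t(1) p(1)] by blast
  then have "num_alpha \<tau>' = num_alpha \<tau>"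
    using t p exotic_tree_remove_beta[OF t(1) p(1,2)]
    by (simp add: num_alpha.abs_eq eiso_refl remove_verts_def)
  then show ?thesis using m_beta_nonzeroD[OF assms] by (simp add: esize_def)
qed

abbreviation growth_weight :: "nat \<Rightarrow> etree \<Rightarrow> int" where
  "growth_weight n \<equiv> Poly_Mapping.lookup ((frag_extend growth ^^ n) (frag_of bullet))"

text \<open>
  The last growth step is split off. The sum may run over the trees from which \<open>\<tau>\<close> can be grown in
  one step, as the other trees do not contribute to the coefficient of \<open>\<tau>\<close>.
\<close>

lemma growth_weight_Suc:
  "growth_weight (Suc n) \<tau> * int (esigma \<tau>)
    = (\<Sum>\<tau>'\<in>{\<tau>'. m_alpha \<tau>' \<tau> \<noteq> 0} \<union> {\<tau>'. m_beta \<tau>' \<tau> \<noteq> 0}.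
        growth_weight n \<tau>' * int (esigma \<tau>') * int (m_alpha \<tau>' \<tau> + 2 * m_beta \<tau>' \<tau>))"
    (is "_ = sum ?f ?S")
proof -
  let ?K = "Poly_Mapping.keys ((frag_extend growth ^^ n) (frag_of bullet))"
  have "growth_weight (Suc n) \<tau> * int (esigma \<tau>)
      = (\<Sum>\<tau>'\<in>?K. growth_weight n \<tau>' * (Poly_Mapping.lookup (growth \<tau>') \<tau> * int (esigma \<tau>)))"
    by (simp add: frag_extend_def lookup_sum sum_distrib_right mult.assoc)
  also have "\<dots> = sum ?f ?K"
    unfolding growth_coefficient by (simp add: ac_simps)
  also have "\<dots> = sum ?f (?K \<union> ?S)"
    by (intro sum.mono_neutral_left) (auto simp: finite_m_support[simplified] in_keys_iff)
  also have "\<dots> = sum ?f ?S"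
    by (intro sum.mono_neutral_right) (auto simp: finite_m_support[simplified])
  finally show ?thesis .
qed

text \<open>
  The power of \<open>1/2\<close> on the left is the one of \<open>\<tau>\<close>. Along an \<open>\<alpha>\<close>-step it is the one of the smaller
  tree; along a \<open>\<beta>\<close>-step it has one more factor \<open>1/2\<close>, which cancels the \<open>2\<close> in front of
  \<open>m_beta\<close>. The factorial absorbs the factor \<open>esize \<tau>\<close> of the recursion of \<open>inv_tree_fact\<close>.
\<close>

lemma growth_weight_eq:
  assumes "esize \<tau> = Suc n"
  shows "(1 / 2) ^ (num_beta \<tau> div 2) * of_int (growth_weight n \<tau>) * of_nat (esigma \<tau>)
    = (fact (Suc n) * inv_tree_fact \<tau> :: rat)"
  using assms
proof (induction n arbitrary: \<tau>)
  case 0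
  then have b: "\<tau> = bullet" by (intro esize_eq_1D) simp
  have "esigma bullet = 1"
  proof -
    have "{f. f permutes {0::nat} \<and> is_iso f bullet_rep bullet_rep} = {id}"
      using is_iso_refl[of bullet_rep] by (auto simp: id_def)
    then show ?thesis using esigma_abs[OF exotic_tree_bullet]
      by (simp add: bullet.abs_eq) (simp add: bullet_rep_def)
  qed
  then show ?case by (simp add: b esize_bullet inv_tree_fact_bullet)
next
  case (Suc n)
  let ?A = "{\<tau>'. m_alpha \<tau>' \<tau> \<noteq> 0}" and ?B = "{\<tau>'. m_beta \<tau>' \<tau> \<noteq> 0}"
  define h :: rat where "h = (1 / 2) ^ (num_beta \<tau> div 2)"
  define F :: rat where "F = fact (Suc n)"
  note fin = finite_m_support[of \<tau>]
  have step: "h * of_int (growth_weight n \<tau>') * of_nat (esigma \<tau>') * of_nat (m_alpha \<tau>' \<tau> + 2 * m_beta \<tau>' \<tau>)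
    = F * (of_nat (m_alpha \<tau>' \<tau>) * inv_tree_fact \<tau>' + of_nat (m_beta \<tau>' \<tau>) * inv_tree_fact \<tau>')"
    if "\<tau>' \<in> ?A \<union> ?B" for \<tau>'
  proof -
    have "esize \<tau>' = Suc n"
      using that Suc.prems m_alpha_nonzeroD[of \<tau>' \<tau>] m_beta_nonzeroD[of \<tau>' \<tau>] by auto
    then have IH: "(1 / 2) ^ (num_beta \<tau>' div 2) * of_int (growth_weight n \<tau>') * of_nat (esigma \<tau>')
      = F * inv_tree_fact \<tau>'"
      unfolding F_def by (rule Suc.IH)
    have a: "h * of_int (growth_weight n \<tau>') * of_nat (esigma \<tau>') * of_nat (m_alpha \<tau>' \<tau>)
      = F * inv_tree_fact \<tau>' * of_nat (m_alpha \<tau>' \<tau>)"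
      using num_beta_remove_alpha[of \<tau>' \<tau>] by (cases "m_alpha \<tau>' \<tau> = 0") (simp_all add: h_def flip: IH)
    have b: "h * of_int (growth_weight n \<tau>') * of_nat (esigma \<tau>') * (2 * of_nat (m_beta \<tau>' \<tau>))
      = F * inv_tree_fact \<tau>' * of_nat (m_beta \<tau>' \<tau>)"
      using num_beta_remove_beta[of \<tau>' \<tau>] by (cases "m_beta \<tau>' \<tau> = 0") (simp_all add: h_def flip: IH)
    show ?thesis
      using arg_cong2[OF a b, of "(+)"]
      by (simp only: of_nat_add of_nat_mult of_nat_numeral distrib_left ac_simps)
  qed
  have "h * of_int (growth_weight (Suc n) \<tau>) * of_nat (esigma \<tau>)
      = h * of_int (growth_weight (Suc n) \<tau> * int (esigma \<tau>))" by simp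
  also have "\<dots> = (\<Sum>\<tau>'\<in>?A \<union> ?B. h * of_int (growth_weight n \<tau>') * of_nat (esigma \<tau>')
      * of_nat (m_alpha \<tau>' \<tau> + 2 * m_beta \<tau>' \<tau>))"
    unfolding growth_weight_Suc by (simp add: sum_distrib_left mult.assoc del: of_nat_add)
  also have "\<dots> = (\<Sum>\<tau>'\<in>?A \<union> ?B. F * (of_nat (m_alpha \<tau>' \<tau>) * inv_tree_fact \<tau>'
      + of_nat (m_beta \<tau>' \<tau>) * inv_tree_fact \<tau>'))"
    using refl step by (rule sum.cong)
  also have "\<dots> = F * ((\<Sum>\<tau>'\<in>?A \<union> ?B. of_nat (m_alpha \<tau>' \<tau>) * inv_tree_fact \<tau>')
      + (\<Sum>\<tau>'\<in>?A \<union> ?B. of_nat (m_beta \<tau>' \<tau>) * inv_tree_fact \<tau>'))"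
    by (simp only: sum_distrib_left[symmetric] sum.distrib)
  also have "(\<Sum>\<tau>'\<in>?A \<union> ?B. of_nat (m_alpha \<tau>' \<tau>) * inv_tree_fact \<tau>')
      = (\<Sum>\<tau>'\<in>?A. of_nat (m_alpha \<tau>' \<tau>) * inv_tree_fact \<tau>')"
    using fin by (intro sum.mono_neutral_right) auto
  also have "(\<Sum>\<tau>'\<in>?A \<union> ?B. of_nat (m_beta \<tau>' \<tau>) * inv_tree_fact \<tau>')
      = (\<Sum>\<tau>'\<in>?B. of_nat (m_beta \<tau>' \<tau>) * inv_tree_fact \<tau>')"
    using fin by (intro sum.mono_neutral_right) auto
  also have "F * ((\<Sum>\<tau>'\<in>?A. of_nat (m_alpha \<tau>' \<tau>) * inv_tree_fact \<tau>')
      + (\<Sum>\<tau>'\<in>?B. of_nat (m_beta \<tau>' \<tau>) * inv_tree_fact \<tau>'))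
      = F * (of_nat (Suc (Suc n)) * inv_tree_fact \<tau>)"
    using inv_tree_fact_rec[of \<tau>] Suc.prems by simp
  also have "\<dots> = fact (Suc (Suc n)) * inv_tree_fact \<tau>"
    unfolding F_def fact_Suc[of "Suc n"] by (simp only: ac_simps)
  finally show ?case unfolding h_def .
qed

theorem lemma2p19:
  fixes \<tau> :: etree
  shows "CM \<tau> = fact (esize \<tau>) / of_nat (esigma \<tau>) * inv_tree_fact \<tau>"
proof -
  have "esize \<tau> = Suc (esize \<tau> - 1)" by (simp add: esize_def)
  from growth_weight_eq[OF this] this have "CM \<tau> * of_nat (esigma \<tau>) = fact (esize \<tau>) * inv_tree_fact \<tau>"
    by (simp add: CM_def)
  then show ?thesis using esigma_pos[of \<tau>] by (simp add: field_simps)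
qed

end
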